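(* Let $m\ge 1$ and let $G=(g_1,\ldots,g_m)\in\mathcal{R}^m$ be a Pham-like system of nonzero polynomials. The following are equivalent: (A) $G$ is a Gröbner basis with respect to $\prec$. (B) The $S$-polynomials $S_{\prec}(g_1,g_2), S_{\prec}(g_2,g_3),\ldots,S_{\prec}(g_{m-1},g_m)$ all reduce to zero with respect to $G$.
   Context: $\mathcal{R}=\mathbb{F}[x_1,\ldots,x_n]$ is a commutative polynomial ring over a field $\mathbb{F}$. A monomial is a nonzero scalar times a product of powers of the variables; a term is a monomial with coefficient $1$. $\prec$ is a fixed admissible term ordering (monomial order) on the terms of $\mathcal{R}$. For nonzero $p\in\mathcal{R}$, $\mathrm{lt}_{\prec}(p)$ is its leading term (with coefficient $1$) and $\mathrm{lc}_{\prec}(p)$ its leading coefficient. A term is "a term of $p$" if it occurs in $p$ with nonzero coefficient. Gröbner basis: $G=(g_1,\ldots,g_m)$ is a Gröbner basis with respect to $\prec$ if for every nonzero $p$ in the ideal generated by $G$ there is some $g\in G$ with $\mathrm{lt}_{\prec}(g)\mid\mathrm{lt}_{\prec}(p)$. $S$-polynomial: $\sigma_{f,g}=\mathrm{lcm}(\mathrm{lt}_{\prec}(f),\mathrm{lt}_{\prec}(g))/\mathrm{lt}_{\prec}(f)$ and $S_{\prec}(f,g)=\mathrm{lc}_{\prec}(g)\,\sigma_{f,g}\,f-\mathrm{lc}_{\prec}(f)\,\sigma_{g,f}\,g$, for nonzero $f,g\in\mathcal{R}$. Reduction to zero: $p\in\mathcal{R}$ reduces to zero with respect to $G=(g_1,\ldots,g_m)$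 if $p=0$ or there exist monomials $q_1,\ldots,q_s$ and indices $\nu_1,\ldots,\nu_s\in\{1,\ldots,m\}$ such that $p=q_1g_{\nu_1}+\cdots+q_sg_{\nu_s}$; $\mathrm{lt}_{\prec}(q_1)\mathrm{lt}_{\prec}(g_{\nu_1})$ is a term of $p$; and for each $i>1$, $\mathrm{lt}_{\prec}(q_i)\mathrm{lt}_{\prec}(g_{\nu_i})$ is a term of $p-q_1g_{\nu_1}-\cdots-q_{i-1}g_{\nu_{i-1}}$. Pham-like system: $G=(g_1,\ldots,g_m)$ is a Pham-like system if there are terms $c_1,\ldots,c_m,d$ such that $\mathrm{lt}_{\prec}(g_i)=c_id$ for all $i$, each $c_i$ is relatively prime to $d$, and $c_i$ and $c_j$ are relatively prime whenever $i\ne j$. *)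

theory Defs
  imports Complex_Main "HOL-Library.Poly_Mapping"
begin

text \<open>
  Polynomials over \<open>'a\<close> in the variables \<open>'x\<close> are finitely supported functions from
  exponent vectors to coefficients. Terms (power products) are the exponent vectors themselves, so
  the monoid of terms is written additively: \<open>0\<close> is the term \<open>1\<close>, \<open>s + t\<close> is the product of
  \<open>s\<close> and \<open>t\<close>, and \<open>s - t\<close> is the quotient \<open>s / t\<close> if \<open>t\<close> divides \<open>s\<close>.
  The terms of \<open>p\<close> are \<open>Poly_Mapping.keys p\<close>.
\<close>

type_synonym 'x pp = "'x \<Rightarrow>\<^sub>0 nat"

type_synonym ('x, 'a) mpol = "('x \<Rightarrow>\<^sub>0 nat) \<Rightarrow>\<^sub>0 'a"

definition pp_dvd :: "'x pp \<Rightarrow> 'x pp \<Rightarrow> bool" where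
  "pp_dvd s t \<longleftrightarrow> (\<exists>u. t = s + u)"

definition pp_coprime :: "'x pp \<Rightarrow> 'x pp \<Rightarrow> bool" where
  "pp_coprime s t \<longleftrightarrow> (\<forall>u. pp_dvd u s \<and> pp_dvd u t \<longrightarrow> u = 0)"

lift_definition pp_lcm :: "'x pp \<Rightarrow> 'x pp \<Rightarrow> 'x pp"
  is "\<lambda>s t x. max (s x) (t x)"
proof -
  fix s t :: "'x \<Rightarrow> nat"
  assume "finite {x. s x \<noteq> 0}" "finite {x. t x \<noteq> 0}"
  then show "finite {x. max (s x) (t x) \<noteq> 0}"
    by (rule_tac finite_subset[of _ "{x. s x \<noteq> 0} \<union> {x. t x \<noteq> 0}"]) auto
qed

text \<open>
  Orderings are given by their strict part. For finitely many variables, well-foundedness follows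
  from the conditions below.
\<close>

definition admissible :: "('x pp \<Rightarrow> 'x pp \<Rightarrow> bool) \<Rightarrow> bool" where
  "admissible prec \<longleftrightarrow>
     irreflp prec \<and> transp prec \<and> totalp prec \<and>
     (\<forall>t. t \<noteq> 0 \<longrightarrow> prec 0 t) \<and>
     (\<forall>s t u. prec s t \<longrightarrow> prec (s + u) (t + u))"

text \<open>The leading term is meaningful only for nonzero polynomials.\<close>

definition lead_term :: "('x pp \<Rightarrow> 'x pp \<Rightarrow> bool) \<Rightarrow> ('x, 'a::zero) mpol \<Rightarrow> 'x pp" where
  "lead_term prec p = (THE t. t \<in> Poly_Mapping.keys p \<and> (\<forall>s\<in>Poly_Mapping.keys p. s \<noteq> t \<longrightarrow> prec s t))"

definition leading_coeff :: "('x pp \<Rightarrow> 'x pp \<Rightarrow> bool) \<Rightarrow> ('x, 'a::zero) mpol \<Rightarrow> 'a" where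
  "leading_coeff prec p = Poly_Mapping.lookup p (lead_term prec p)"

definition is_monomial :: "('x, 'a::zero) mpol \<Rightarrow> bool" where
  "is_monomial q \<longleftrightarrow> (\<exists>t c. c \<noteq> 0 \<and> q = Poly_Mapping.single t c)"

text \<open>The ideal generated by \<open>B\<close> is the span of \<open>B\<close> in the ring regarded as a module over itself.\<close>

definition ideal_of :: "('x, 'a::comm_ring_1) mpol set \<Rightarrow> ('x, 'a) mpol set" where
  "ideal_of B = module.span (*) B"

lemma module_mpol: "module ((*) :: ('x, 'a::comm_ring_1) mpol \<Rightarrow> _)"
  by unfold_locales (simp_all add: algebra_simps)

definition groebner_basis ::
  "('x pp \<Rightarrow> 'x pp \<Rightarrow> bool) \<Rightarrow> ('x, 'a::comm_ring_1) mpol list \<Rightarrow> bool" where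
  "groebner_basis prec G \<longleftrightarrow>
     (\<forall>p \<in> ideal_of (set G). p \<noteq> 0 \<longrightarrow>
        (\<exists>g \<in> set G. pp_dvd (lead_term prec g) (lead_term prec p)))"

definition cofactor ::
  "('x pp \<Rightarrow> 'x pp \<Rightarrow> bool) \<Rightarrow> ('x, 'a::zero) mpol \<Rightarrow> ('x, 'a) mpol \<Rightarrow> 'x pp" where
  "cofactor prec f g = pp_lcm (lead_term prec f) (lead_term prec g) - lead_term prec f"

definition S_poly ::
  "('x pp \<Rightarrow> 'x pp \<Rightarrow> bool) \<Rightarrow> ('x, 'a::comm_ring_1) mpol \<Rightarrow> ('x, 'a) mpol \<Rightarrow> ('x, 'a) mpol" where
  "S_poly prec f g =
     Poly_Mapping.single (cofactor prec f g) (leading_coeff prec g) * f -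
     Poly_Mapping.single (cofactor prec g f) (leading_coeff prec f) * g"

text \<open>
  Positions in the list \<open>G\<close> and in the sequence of monomials \<open>q\<close> are counted from \<open>0\<close>.
  The condition for \<open>i = 0\<close> says that the product of leading terms is a term of \<open>p\<close> itself.
  It need not be the leading term, and the step need not cancel it.
\<close>

definition reduces_to_zero ::
  "('x pp \<Rightarrow> 'x pp \<Rightarrow> bool) \<Rightarrow> ('x, 'a::comm_ring_1) mpol list \<Rightarrow> ('x, 'a) mpol \<Rightarrow> bool" where
  "reduces_to_zero prec G p \<longleftrightarrow>
     p = 0 \<or>
     (\<exists>(s::nat) (q :: nat \<Rightarrow> ('x, 'a) mpol) (\<nu> :: nat \<Rightarrow> nat).
        (\<forall>i<s. is_monomial (q i) \<and> \<nu> i < length G) \<and>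
        p = (\<Sum>i<s. q i * G ! \<nu> i) \<and>
        (\<forall>i<s. lead_term prec (q i) + lead_term prec (G ! \<nu> i)
                 \<in> Poly_Mapping.keys (p - (\<Sum>j<i. q j * G ! \<nu> j))))"

definition pham_like ::
  "('x pp \<Rightarrow> 'x pp \<Rightarrow> bool) \<Rightarrow> ('x, 'a::zero) mpol list \<Rightarrow> bool" where
  "pham_like prec G \<longleftrightarrow>
     (\<exists>(c :: nat \<Rightarrow> 'x pp) (d :: 'x pp).
        (\<forall>i<length G. lead_term prec (G ! i) = c i + d) \<and>
        (\<forall>i<length G. pp_coprime (c i) d) \<and>
        (\<forall>i<length G. \<forall>j<length G. i \<noteq> j \<longrightarrow> pp_coprime (c i) (c j)))"

end

theory Submission
  imports Defs "HOL-Computational_Algebra.Factorial_Ring"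
begin

text \<open>
  Reduction to zero is understood in a weak sense here: a step need not cancel anything. Still, every
  product \<open>q * g\<close> that occurs has its leading term among the terms of the current remainder, so
  all of them stay below any bound on the terms of the polynomial that is reduced
  (\<open>reduces_to_zero_imp_combination\<close>). The S-polynomial of two members of \<open>G\<close> lies below
  the least common multiple of their leading terms (\<open>S_poly_below\<close>); if it reduces to zero, it
  therefore yields a syzygy of \<open>G\<close> with precisely known leading terms (\<open>S_poly_syzygy\<close>).

  Suppose that all consecutive S-polynomials of \<open>g 0, ..., g n\<close> reduce to zero, where \<open>n \<ge> 1\<close>
  and the leading term of \<open>g j\<close> is \<open>c j + d\<close>. The \<open>n\<close> syzygies form an
  \<open>n\<close> by \<open>n + 1\<close> matrix which, as far as leading terms are concerned, only has a diagonal and a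
  superdiagonal. Linear algebra (\<open>chain_elimination\<close>) gives polynomials \<open>P j\<close> that are
  proportional to the \<open>g j\<close>, that is, \<open>P j * g k = P k * g j\<close>, and whose leading terms are
  \<open>c j + e\<close> for some \<open>e\<close> coprime to \<open>d\<close>; one could take the maximal minors of the matrix.

  Now unique factorization enters (\<open>irreducible_prime_in\<close>): write the fraction \<open>P 0 / g 0\<close> in
  lowest terms as \<open>a / b\<close>. Then \<open>b\<close> divides all \<open>g j\<close>, and a comparison of leading
  terms shows that the leading term of \<open>b\<close> is exactly \<open>d\<close> (\<open>common_factor_of_chain\<close>).
  So \<open>g j = b * f j\<close>, where the leading terms \<open>c j\<close> of the \<open>f j\<close> are pairwise coprime.
  Polynomials with pairwise coprime leading terms always form a Groebner basis
  (\<open>combination_lead_dvd_of_coprime\<close>), and multiplying them by \<open>b\<close> preserves this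
  (\<open>groebner_of_common_factor\<close>).

  Conversely, relative to a Groebner basis any member of the ideal, in particular an S-polynomial,
  reduces to zero by cancelling leading terms (\<open>groebner_imp_reduces_to_zero\<close>). This process
  ends because an admissible ordering is well-founded, which is Dickson's lemma.
\<close>

section \<open>Terms and Dickson's lemma\<close>

lemma pp_dvd_iff: "pp_dvd s t \<longleftrightarrow> (\<forall>x. Poly_Mapping.lookup s x \<le> Poly_Mapping.lookup t x)"
proof
  assume "\<forall>x. Poly_Mapping.lookup s x \<le> Poly_Mapping.lookup t x"
  then have "t = s + (t - s)"
    by (intro poly_mapping_eqI) (simp add: lookup_add lookup_minus)
  then show "pp_dvd s t"
    unfolding pp_dvd_def by blast
qed (auto simp: pp_dvd_def lookup_add)

lemma pp_dvd_add_minus: "pp_dvd s t \<Longrightarrow> (t - s) + s = t"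
  by (intro poly_mapping_eqI) (simp add: pp_dvd_iff lookup_add lookup_minus)

lemma pp_coprime_iff:
  "pp_coprime s t \<longleftrightarrow> (\<forall>x. Poly_Mapping.lookup s x = 0 \<or> Poly_Mapping.lookup t x = 0)"
proof
  assume cop: "pp_coprime s t"
  show "\<forall>x. Poly_Mapping.lookup s x = 0 \<or> Poly_Mapping.lookup t x = 0"
  proof (rule ccontr, clarsimp)
    fix x
    assume "Poly_Mapping.lookup s x > 0" "Poly_Mapping.lookup t x > 0"
    then have "pp_dvd (Poly_Mapping.single x 1) s" "pp_dvd (Poly_Mapping.single x 1) t"
      by (auto simp: pp_dvd_iff lookup_single when_def)
    with cop have "Poly_Mapping.single x (1::nat) = 0"
      unfolding pp_coprime_def by blast
    then show False
      by (metis lookup_single_eq lookup_zero one_neq_zero)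
  qed
next
  assume "\<forall>x. Poly_Mapping.lookup s x = 0 \<or> Poly_Mapping.lookup t x = 0"
  then have "Poly_Mapping.lookup u x = 0" if "pp_dvd u s" "pp_dvd u t" for u x
    using that unfolding pp_dvd_iff by (metis le_zero_eq)
  then have "u = 0" if "pp_dvd u s" "pp_dvd u t" for u
    using that by (intro poly_mapping_eqI) simp
  then show "pp_coprime s t"
    unfolding pp_coprime_def by blast
qed

lemma pp_coprime_sym: "pp_coprime s t \<Longrightarrow> pp_coprime t s"
  unfolding pp_coprime_iff by metis

lemma pp_coprime_add: "pp_coprime s u \<Longrightarrow> pp_coprime t u \<Longrightarrow> pp_coprime (s + t) u"
  unfolding pp_coprime_iff lookup_add by (metis add.right_neutral)

lemma pp_coprime_dvd: "pp_coprime t u \<Longrightarrow> pp_dvd s t \<Longrightarrow> pp_coprime s u"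
  unfolding pp_coprime_iff pp_dvd_iff by (metis le_zero_eq)

lemma pp_coprime_dvd_add: "pp_coprime s u \<Longrightarrow> pp_dvd s (t + u) \<Longrightarrow> pp_dvd s t"
  unfolding pp_coprime_iff pp_dvd_iff lookup_add by (metis add.right_neutral le0)

lemma pp_lcm_coprime:
  assumes "pp_coprime s t"
  shows "pp_lcm (s + d) (t + d) = s + t + d"
proof (rule poly_mapping_eqI)
  fix x
  show "Poly_Mapping.lookup (pp_lcm (s + d) (t + d)) x = Poly_Mapping.lookup (s + t + d) x"
    using assms[unfolded pp_coprime_iff, rule_format, of x]
    by (auto simp: pp_lcm.rep_eq lookup_add)
qed

lemma nat_seq_incseq_subseq:
  fixes f :: "nat \<Rightarrow> nat"
  shows "\<exists>r. strict_mono r \<and> incseq (\<lambda>n. f (r n))"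
proof -
  obtain r where r: "strict_mono r" "monoseq (\<lambda>n. f (r n))"
    using seq_monosub by blast
  show ?thesis
  proof (cases "incseq (\<lambda>n. f (r n))")
    case False
    with r(2) have dec: "decseq (\<lambda>n. f (r n))"
      by (simp add: monoseq_iff)
    \<comment> \<open>A decreasing sequence of naturals is constant once it has reached its minimum.\<close>
    obtain m where m: "\<And>n. f (r m) \<le> f (r n)"
      using ex_has_least_nat[of "\<lambda>_. True" 0 "\<lambda>n. f (r n)"] by auto
    have "f (r (m + n)) = f (r m)" for n
      using m[of "m + n"] decseqD[OF dec, of m "m + n"] by simp
    moreover have "strict_mono (\<lambda>n. r (m + n))"
      using r(1) by (simp add: strict_mono_def)
    ultimately show ?thesis
      by (intro exI[of _ "\<lambda>n. r (m + n)"]) (simp add: incseq_def)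
  qed (use r(1) in blast)
qed

text \<open>Dickson's lemma: each variable in turn only requires passing to a further subsequence.\<close>

lemma Dickson:
  fixes f :: "nat \<Rightarrow> 'x::finite pp"
  shows "\<exists>i j. i < j \<and> pp_dvd (f i) (f j)"
proof -
  have "\<exists>r. strict_mono r \<and> (\<forall>x\<in>X. incseq (\<lambda>n. Poly_Mapping.lookup (f (r n)) x))"
    if "finite X" for X :: "'x set"
    using that
  proof induction
    case empty
    show ?case
      using strict_mono_id by (auto simp: id_def)
  next
    case (insert x X)
    then obtain r where r: "strict_mono r" "\<And>y. y \<in> X \<Longrightarrow> incseq (\<lambda>n. Poly_Mapping.lookup (f (r n)) y)"
      by blast
    obtain r' where r': "strict_mono r'" "incseq (\<lambda>n. Poly_Mapping.lookup (f (r (r' n))) x)"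
      using nat_seq_incseq_subseq[of "\<lambda>n. Poly_Mapping.lookup (f (r n)) x"] by blast
    have "incseq (\<lambda>n. Poly_Mapping.lookup (f (r (r' n))) y)" if "y \<in> X" for y
      using r(2)[OF that] strict_mono_mono[OF r'(1)] by (auto simp: incseq_def mono_def)
    moreover have "strict_mono (\<lambda>n. r (r' n))"
      using r(1) r'(1) by (simp add: strict_mono_def)
    ultimately show ?case
      using r'(2) by (intro exI[of _ "\<lambda>n. r (r' n)"]) auto
  qed
  from this[of UNIV] obtain r where r: "strict_mono r"
    "\<And>x. incseq (\<lambda>n. Poly_Mapping.lookup (f (r n)) x)"
    by auto
  have "pp_dvd (f (r 0)) (f (r 1))"
    using r(2) by (auto simp: pp_dvd_iff incseq_def)
  moreover have "r 0 < r 1"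
    using r(1) by (simp add: strict_mono_def)
  ultimately show ?thesis by blast
qed

section \<open>Leading terms\<close>

lemma in_keys_minus: "t \<in> Poly_Mapping.keys (p - q) \<Longrightarrow> t \<in> Poly_Mapping.keys p \<or> t \<in> Poly_Mapping.keys q"
  by (auto simp: in_keys_iff lookup_minus)

lemma in_keys_sum: "t \<in> Poly_Mapping.keys (\<Sum>i\<in>I. f i) \<Longrightarrow> \<exists>i\<in>I. t \<in> Poly_Mapping.keys (f i)"
  by (induction I rule: infinite_finite_induct) (use keys_add in fastforce)+

lemma in_keys_multE:
  assumes "t \<in> Poly_Mapping.keys (p * q)"
  obtains u v where "t = u + v" "u \<in> Poly_Mapping.keys p" "v \<in> Poly_Mapping.keys q"
  using assms keys_mult[of p q] by blast

locale term_order =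
  fixes prec :: "'x::finite pp \<Rightarrow> 'x pp \<Rightarrow> bool"  (infix \<open>\<prec>\<close> 50)
  assumes admissible: "admissible (\<prec>)"
begin

abbreviation preceq :: "'x pp \<Rightarrow> 'x pp \<Rightarrow> bool"  (infix \<open>\<preceq>\<close> 50)
  where "s \<preceq> t \<equiv> s \<prec> t \<or> s = t"

lemma irrefl [simp]: "\<not> t \<prec> t"
  using admissible by (auto simp: admissible_def irreflp_def)

lemma prec_trans [trans]: "s \<prec> t \<Longrightarrow> t \<prec> u \<Longrightarrow> s \<prec> u"
  using transpD[of "(\<prec>)"] admissible by (simp add: admissible_def)

lemma prec_asym: "s \<prec> t \<Longrightarrow> \<not> t \<prec> s"
  using prec_trans irrefl by metis

lemma prec_linear: "s \<prec> t \<or> s = t \<or> t \<prec> s"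
  using totalpD[of "(\<prec>)"] admissible by (auto simp: admissible_def)

lemma zero_preceq: "0 \<preceq> t"
  using admissible by (auto simp: admissible_def)

lemma add_right_mono: "s \<prec> t \<Longrightarrow> s + u \<prec> t + u"
  using admissible by (auto simp: admissible_def)

lemma add_left_mono: "s \<prec> t \<Longrightarrow> u + s \<prec> u + t"
  by (metis add.commute add_right_mono)

lemma add_right_cancel_prec: "s + u \<prec> t + u \<Longrightarrow> s \<prec> t"
  using prec_linear[of s t] add_right_mono[of t s u] prec_trans irrefl by blast

lemma add_prec_preceq: "s \<prec> t \<Longrightarrow> u \<preceq> v \<Longrightarrow> s + u \<prec> t + v"
  using add_right_mono[of s t u] add_left_mono[of u v t] prec_trans by blast

lemma add_preceq_prec: "s \<preceq> t \<Longrightarrow> u \<prec> v \<Longrightarrow> s + u \<prec> t + v"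
  by (metis add.commute add_prec_preceq)

lemma dvd_imp_preceq: "pp_dvd s t \<Longrightarrow> s \<preceq> t"
  unfolding pp_dvd_def using zero_preceq add_left_mono by fastforce

text \<open>
  Along a descending sequence, Dickson's lemma finds a term that divides a later one, although
  a divisor never exceeds its multiples.
\<close>

lemma wf_prec: "wfp (\<prec>)"
proof (rule ccontr)
  assume "\<not> wfp (\<prec>)"
  then obtain f where f: "\<And>i. f (Suc i) \<prec> f i"
    unfolding wfp_def wf_iff_no_infinite_down_chain by auto
  have desc: "f j \<prec> f i" if "i < j" for i j
    using that
  proof (induction j)
    case (Suc j)
    then show ?case
      using f[of j] prec_trans less_SucE by blast
  qed simp
  obtain i j where "i < j" "pp_dvd (f i) (f j)"
    using Dickson by blast
  then show False
    using desc dvd_imp_preceq prec_trans irrefl by metis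
qed

text \<open>
  As a relation, unlike \<open>lead_term\<close>, this is false for the zero polynomial, so that a leading term
  carries the fact that the polynomial is nonzero.
\<close>

definition lead :: "('x, 'a::zero) mpol \<Rightarrow> 'x pp \<Rightarrow> bool" where
  "lead p t \<longleftrightarrow> t \<in> Poly_Mapping.keys p \<and> (\<forall>s\<in>Poly_Mapping.keys p. s \<preceq> t)"

text \<open>
  The shift \<open>c\<close> serves to bound the product of \<open>p\<close> with a polynomial of leading term \<open>c\<close> by a
  condition on \<open>p\<close> alone, without quotients of terms.
\<close>

definition below :: "('x, 'a::zero) mpol \<Rightarrow> 'x pp \<Rightarrow> 'x pp \<Rightarrow> bool" where
  "below p c u \<longleftrightarrow> (\<forall>t\<in>Poly_Mapping.keys p. t + c \<prec> u)"

lemma lead_unique: "lead p s \<Longrightarrow> lead p t \<Longrightarrow> s = t"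
  unfolding lead_def using prec_asym by blast

lemma lead_lead_term:
  assumes "p \<noteq> 0"
  shows "lead p (lead_term (\<prec>) p)"
proof -
  have "\<exists>t\<in>K. \<forall>s\<in>K. s \<preceq> t" if "finite K" "K \<noteq> {}" for K :: "'x pp set"
    using that
  proof (induction rule: finite_ne_induct)
    case (insert x F)
    then obtain t where "t \<in> F" "\<forall>s\<in>F. s \<preceq> t" by blast
    then show ?case
      using prec_linear[of x t] prec_trans by blast
  qed simp
  from this[of "Poly_Mapping.keys p"] assms obtain t where "lead p t"
    unfolding lead_def by auto
  then have "lead_term (\<prec>) p = t"
    unfolding lead_term_def
  proof (intro the_equality)
    fix s
    assume "s \<in> Poly_Mapping.keys p \<and> (\<forall>u\<in>Poly_Mapping.keys p. u \<noteq> s \<longrightarrow> u \<prec> s)"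
    with \<open>lead p t\<close> show "s = t"
      by (intro lead_unique[of p]) (auto simp: lead_def)
  qed (auto simp: lead_def)
  with \<open>lead p t\<close> show ?thesis by simp
qed

lemma lead_nonzero: "lead p t \<Longrightarrow> p \<noteq> 0"
  by (auto simp: lead_def)

lemma lead_term_eq: "lead p t \<Longrightarrow> lead_term (\<prec>) p = t"
  using lead_lead_term lead_unique lead_nonzero by metis

lemma lead_single: "a \<noteq> 0 \<Longrightarrow> lead (Poly_Mapping.single t a) t"
  by (simp add: lead_def)

lemma below_0 [simp]: "below 0 c u"
  by (simp add: below_def)

lemma below_diff: "below p c u \<Longrightarrow> below q c u \<Longrightarrow> below (p - q) c u"
  unfolding below_def by (blast dest: in_keys_minus)

lemma below_add: "below p c u \<Longrightarrow> below q c u \<Longrightarrow> below (p + q) c u"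
  unfolding below_def using keys_add[of p q] by auto

lemma below_sum: "(\<And>i. i \<in> I \<Longrightarrow> below (f i) c u) \<Longrightarrow> below (\<Sum>i\<in>I. f i) c u"
  unfolding below_def by (blast dest: in_keys_sum)

lemma lead_add_below:
  assumes "lead p t" "below q 0 t"
  shows "lead (p + q) t"
proof -
  have "Poly_Mapping.lookup q t = 0"
    using assms(2) unfolding below_def by (metis add_0_right in_keys_iff irrefl)
  with assms show ?thesis
    unfolding lead_def below_def using keys_add[of p q] by (auto simp: in_keys_iff lookup_add)
qed

lemma lead_uminus: "lead p t \<Longrightarrow> lead (- p :: ('x, 'a::comm_ring_1) mpol) t"
  by (auto simp: lead_def in_keys_iff)

lemma below_uminus: "below p c u \<Longrightarrow> below (- p :: ('x, 'a::comm_ring_1) mpol) c u"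
  by (auto simp: below_def in_keys_iff)

lemma lead_decompose:
  fixes p :: "('x, 'a::comm_ring_1) mpol"
  assumes "lead p t"
  obtains q where "Poly_Mapping.lookup p t \<noteq> 0"
    "p = Poly_Mapping.single t (Poly_Mapping.lookup p t) + q" "below q 0 t"
proof
  show "Poly_Mapping.lookup p t \<noteq> 0"
    using assms by (simp add: lead_def in_keys_iff)
  show "below (p - Poly_Mapping.single t (Poly_Mapping.lookup p t)) 0 t"
    using assms unfolding below_def lead_def
    by (auto simp: in_keys_iff lookup_minus lookup_single when_def split: if_splits)
qed simp

lemma lead_diff_below:
  fixes p :: "('x, 'a::comm_ring_1) mpol"
  shows "lead p t \<Longrightarrow> below q 0 t \<Longrightarrow> lead (p - q) t"
  using lead_add_below[OF _ below_uminus, of p t q] by simp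

lemma lead_add_distinct:
  fixes p :: "('x, 'a::comm_ring_1) mpol"
  assumes "lead p s" "lead q t" "s \<noteq> t"
  shows "lead (p + q) s \<or> lead (p + q) t"
proof -
  have "below q 0 s" if "t \<prec> s"
    using assms(2) that prec_trans unfolding lead_def below_def by auto
  moreover have "below p 0 t" if "s \<prec> t"
    using assms(1) that prec_trans unfolding lead_def below_def by auto
  ultimately show ?thesis
    using prec_linear[of s t] assms lead_add_below[of p s q] lead_add_below[of q t p]
    by (auto simp: add.commute)
qed

lemma below_mult_left:
  assumes "lead p s" "below q c u"
  shows "below (p * q) c (s + u)"
  unfolding below_def
proof
  fix t
  assume "t \<in> Poly_Mapping.keys (p * q)"
  then obtain a b where ab: "t = a + b" "a \<in> Poly_Mapping.keys p" "b \<in> Poly_Mapping.keys q"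
    by (rule in_keys_multE)
  with assms have "a \<preceq> s" "b + c \<prec> u"
    by (auto simp: lead_def below_def)
  then show "t + c \<prec> s + u"
    using add_preceq_prec ab(1) by (metis add.assoc)
qed

lemma lead_mult:
  fixes p q :: "('x, 'a::field) mpol"
  assumes "lead p s" "lead q t"
  shows "lead (p * q) (s + t)"
proof -
  obtain a p' where p: "a \<noteq> 0" "p = Poly_Mapping.single s a + p'" "below p' 0 s"
    using lead_decompose[OF assms(1)] by blast
  obtain b q' where q: "b \<noteq> 0" "q = Poly_Mapping.single t b + q'" "below q' 0 t"
    using lead_decompose[OF assms(2)] by blast
  have "p * q = Poly_Mapping.single (s + t) (a * b) + (Poly_Mapping.single s a * q' + q * p')"
    by (simp add: p(2) q(2) mult_single algebra_simps)
  moreover have "below (q * p') 0 (s + t)"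
    using below_mult_left[OF assms(2) p(3)] by (simp add: add.commute)
  moreover have "below (Poly_Mapping.single s a * q') 0 (s + t)"
    using below_mult_left[OF lead_single[OF p(1)] q(3)] .
  ultimately show ?thesis
    using p(1) q(1) by (auto intro!: lead_add_below lead_single below_add)
qed

lemma mpol_no_zero_divisors:
  fixes p q :: "('x, 'a::field) mpol"
  assumes "p \<noteq> 0" "q \<noteq> 0"
  shows "p * q \<noteq> 0"
  using lead_mult[OF lead_lead_term[OF assms(1)] lead_lead_term[OF assms(2)]] lead_nonzero by blast

lemma mpol_mult_left_cancel:
  fixes p q r :: "('x, 'a::field) mpol"
  assumes "p \<noteq> 0" "p * q = p * r"
  shows "q = r"
  using mpol_no_zero_divisors[OF assms(1), of "q - r"] assms(2) by (auto simp: right_diff_distrib)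

lemma lead_dvd:
  fixes p q :: "('x, 'a::field) mpol"
  assumes "p dvd q" "lead p s" "lead q t"
  shows "pp_dvd s t"
proof -
  obtain r where r: "q = p * r"
    using assms(1) by blast
  then have "r \<noteq> 0"
    using assms(3) lead_nonzero by fastforce
  then have "lead q (s + lead_term (\<prec>) r)"
    unfolding r by (intro lead_mult assms(2) lead_lead_term)
  then show ?thesis
    using lead_unique[OF assms(3)] by (auto simp: pp_dvd_def)
qed

end

section \<open>Degree and top coefficient in one variable\<close>



definition pols :: "'x set \<Rightarrow> ('x, 'a::comm_ring_1) mpol set" where
  "pols X = {f. \<forall>t\<in>Poly_Mapping.keys f. Poly_Mapping.keys t \<subseteq> X}"

text \<open>
  A strict bound on the degree in \<open>x\<close>, in place of the degree itself, so that \<open>0\<close> needs no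
  convention: only \<open>0\<close> satisfies the bound \<open>0\<close>.
\<close>

definition deg_lt :: "'x \<Rightarrow> nat \<Rightarrow> ('x, 'a::comm_ring_1) mpol \<Rightarrow> bool" where
  "deg_lt x n f \<longleftrightarrow> (\<forall>t\<in>Poly_Mapping.keys f. Poly_Mapping.lookup t x < n)"

definition xpow :: "'x \<Rightarrow> nat \<Rightarrow> ('x, 'a::comm_ring_1) mpol" where
  "xpow x n = Poly_Mapping.single (Poly_Mapping.single x n) 1"

lemma xpow_add: "xpow x (m + n) = xpow x m * xpow x n"
  by (simp add: xpow_def mult_single single_add)

lemma xpow_nonzero: "xpow x n \<noteq> 0"
  unfolding xpow_def by (metis lookup_single_eq lookup_zero one_neq_zero)

lemma pols_UNIV [simp]: "f \<in> pols UNIV"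
  by (simp add: pols_def)

lemma pols_mono: "f \<in> pols X \<Longrightarrow> X \<subseteq> Y \<Longrightarrow> f \<in> pols Y"
  by (auto simp: pols_def)

lemma zero_in_pols [simp]: "0 \<in> pols X"
  by (simp add: pols_def)

lemma one_in_pols [simp]: "1 \<in> pols X"
  by (simp add: pols_def)

lemma pols_add: "f \<in> pols X \<Longrightarrow> g \<in> pols X \<Longrightarrow> f + g \<in> pols X"
  unfolding pols_def using keys_add[of f g] by auto

lemma pols_diff: "f \<in> pols X \<Longrightarrow> g \<in> pols X \<Longrightarrow> f - g \<in> pols X"
  unfolding pols_def by (auto dest!: in_keys_minus)

lemma pols_mult: "f \<in> pols X \<Longrightarrow> g \<in> pols X \<Longrightarrow> f * g \<in> pols X"
  unfolding pols_def
  by (auto elim!: in_keys_multE) (metis UnE in_mono keys_add)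

lemma xpow_in_pols: "x \<in> X \<Longrightarrow> xpow x n \<in> pols X"
  by (simp add: pols_def xpow_def)

lemma pols_sum: "(\<And>i. i \<in> I \<Longrightarrow> f i \<in> pols X) \<Longrightarrow> (\<Sum>i\<in>I. f i) \<in> pols X"
  by (induction I rule: infinite_finite_induct) (auto intro: pols_add)

lemma pols_iff_deg_lt: "f \<in> pols X \<longleftrightarrow> (\<forall>y. y \<notin> X \<longrightarrow> deg_lt y 1 f)"
  by (fastforce simp: pols_def deg_lt_def in_keys_iff)

lemma deg_lt_0_iff: "deg_lt x 0 f \<longleftrightarrow> f = 0"
  by (auto simp: deg_lt_def)

lemma deg_lt_zero [simp]: "deg_lt x n 0"
  by (simp add: deg_lt_def)

lemma deg_lt_mono: "deg_lt x m f \<Longrightarrow> m \<le> n \<Longrightarrow> deg_lt x n f"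
  by (fastforce simp: deg_lt_def)

lemma deg_lt_add: "deg_lt x n f \<Longrightarrow> deg_lt x n g \<Longrightarrow> deg_lt x n (f + g)"
  unfolding deg_lt_def using keys_add[of f g] by auto

lemma deg_lt_diff: "deg_lt x n f \<Longrightarrow> deg_lt x n g \<Longrightarrow> deg_lt x n (f - g)"
  unfolding deg_lt_def by (auto dest!: in_keys_minus)

lemma deg_lt_mult: "deg_lt x (Suc m) f \<Longrightarrow> deg_lt x n g \<Longrightarrow> deg_lt x (m + n) (f * g)"
  unfolding deg_lt_def by (fastforce elim!: in_keys_multE simp: lookup_add)

lemma deg_lt_xpow: "deg_lt x (Suc n) (xpow x n)"
  by (simp add: deg_lt_def xpow_def lookup_single)

lemma deg_lt_mult_pols:
  "a \<in> pols X \<Longrightarrow> x \<notin> X \<Longrightarrow> deg_lt x n f \<Longrightarrow> deg_lt x n (a * f)"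
  using deg_lt_mult[of x 0 a n f] by (simp add: pols_iff_deg_lt)

lemma deg_lt_ex: "\<exists>n. deg_lt x n f"
proof -
  have "deg_lt x (Suc (Max ((\<lambda>t. Poly_Mapping.lookup t x) ` Poly_Mapping.keys f))) f"
    unfolding deg_lt_def by (auto simp: less_Suc_eq_le)
  then show ?thesis ..
qed

lemma sum_monomials: "(\<Sum>t\<in>Poly_Mapping.keys f. Poly_Mapping.single t (Poly_Mapping.lookup f t)) = f"
proof (rule poly_mapping_eqI)
  fix s
  have "Poly_Mapping.lookup (\<Sum>t\<in>Poly_Mapping.keys f. Poly_Mapping.single t (Poly_Mapping.lookup f t)) s
      = (\<Sum>t\<in>Poly_Mapping.keys f. if t = s then Poly_Mapping.lookup f t else 0)"
    by (simp add: lookup_sum lookup_single when_def)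
  also have "\<dots> = Poly_Mapping.lookup f s"
    by (auto simp: in_keys_iff)
  finally show "Poly_Mapping.lookup (\<Sum>t\<in>Poly_Mapping.keys f. Poly_Mapping.single t (Poly_Mapping.lookup f t)) s
      = Poly_Mapping.lookup f s" .
qed

text \<open>
  This is how a polynomial is read as univariate in \<open>x\<close>: all arguments below peel off one power of
  \<open>x\<close> at a time.
\<close>

lemma split_top_coeff:
  fixes f :: "('x, 'a::comm_ring_1) mpol"
  assumes "f \<in> pols X" "deg_lt x (Suc n) f"
  obtains a f' where "f = a * xpow x n + f'" "a \<in> pols (X - {x})" "f' \<in> pols X" "deg_lt x n f'"
proof
  let ?m = "\<lambda>t. Poly_Mapping.single t (Poly_Mapping.lookup f t)"
  let ?K = "{t \<in> Poly_Mapping.keys f. Poly_Mapping.lookup t x = n}"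
  let ?L = "{t \<in> Poly_Mapping.keys f. Poly_Mapping.lookup t x < n}"
  let ?a = "\<Sum>t\<in>?K. Poly_Mapping.single (t - Poly_Mapping.single x n) (Poly_Mapping.lookup f t)"
  have "t - Poly_Mapping.single x n + Poly_Mapping.single x n = t" if "t \<in> ?K" for t
    using that by (intro pp_dvd_add_minus) (auto simp: pp_dvd_iff lookup_single when_def)
  then have "(\<Sum>t\<in>?K. ?m t) = ?a * xpow x n"
    by (auto simp: sum_distrib_right xpow_def mult_single intro!: sum.cong)
  moreover have "Poly_Mapping.keys f = ?K \<union> ?L"
    using assms(2) by (auto simp: deg_lt_def less_Suc_eq)
  then have "(\<Sum>t\<in>Poly_Mapping.keys f. ?m t) = (\<Sum>t\<in>?K. ?m t) + (\<Sum>t\<in>?L. ?m t)"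
    using sum.union_disjoint[of ?K ?L ?m] by auto
  ultimately show "f = ?a * xpow x n + (\<Sum>t\<in>?L. ?m t)"
    by (simp add: sum_monomials)
  show "?a \<in> pols (X - {x})"
  proof (rule pols_sum)
    fix t assume t: "t \<in> ?K"
    then have "Poly_Mapping.keys t \<subseteq> X"
      using assms(1) by (auto simp: pols_def)
    then have "Poly_Mapping.keys (t - Poly_Mapping.single x n) \<subseteq> X - {x}"
      using t by (auto simp: in_keys_iff lookup_minus lookup_single when_def split: if_splits)
    then show "Poly_Mapping.single (t - Poly_Mapping.single x n) (Poly_Mapping.lookup f t) \<in> pols (X - {x})"
      by (simp add: pols_def)
  qed
  show "(\<Sum>t\<in>?L. ?m t) \<in> pols X"
    using assms(1) by (intro pols_sum) (auto simp: pols_def)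
  show "deg_lt x n (\<Sum>t\<in>?L. ?m t)"
    unfolding deg_lt_def by (auto dest!: in_keys_sum split: if_splits)
qed

context term_order
begin

lemma top_coeff_eq_0:
  fixes a :: "('x, 'a::field) mpol"
  assumes "a \<in> pols (- {x})" "deg_lt x n f" "a * xpow x n + f = 0"
  shows "a = 0 \<and> f = 0"
proof -
  have exp: "Poly_Mapping.lookup t x = n" if "t \<in> Poly_Mapping.keys (a * xpow x n)" for t
  proof -
    obtain u v where "t = u + v" "u \<in> Poly_Mapping.keys a" "v \<in> Poly_Mapping.keys (xpow x n :: ('x, 'a) mpol)"
      using \<open>t \<in> _\<close> by (rule in_keys_multE)
    then show ?thesis
      using assms(1) by (auto simp: xpow_def pols_def lookup_add in_keys_iff)
  qed
  have "f = - (a * xpow x n)"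
    using assms(3) by (simp add: eq_neg_iff_add_eq_0 add.commute)
  then have keys: "Poly_Mapping.keys f = Poly_Mapping.keys (a * xpow x n)"
    by (auto simp: in_keys_iff)
  then have "Poly_Mapping.keys f = {}"
    using exp assms(2) unfolding deg_lt_def by (metis less_irrefl ex_in_conv)
  then have "f = 0"
    by simp
  with assms(3) show ?thesis
    using mpol_no_zero_divisors[OF _ xpow_nonzero] by auto
qed

lemma split_lead_coeff:
  fixes f :: "('x, 'a::field) mpol"
  assumes "f \<in> pols X" "f \<noteq> 0"
  obtains n a f' where "f = a * xpow x n + f'" "a \<noteq> 0" "a \<in> pols (X - {x})" "f' \<in> pols X"
    "deg_lt x n f'" "deg_lt x (Suc n) f"
proof -
  define n where "n = (LEAST n. deg_lt x n f)"
  have n: "deg_lt x n f"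
    unfolding n_def using deg_lt_ex by (rule LeastI_ex)
  then obtain m where m: "n = Suc m"
    using assms(2) by (cases n) (auto simp: deg_lt_0_iff)
  obtain a f' where f: "f = a * xpow x m + f'" "a \<in> pols (X - {x})" "f' \<in> pols X" "deg_lt x m f'"
    using split_top_coeff[OF assms(1)] n m by blast
  have "a \<noteq> 0"
  proof
    assume "a = 0"
    then have "deg_lt x m f"
      using f by simp
    then show False
      using not_less_Least[of m "\<lambda>n. deg_lt x n f"] m n_def by simp
  qed
  then show ?thesis
    using that f n m by blast
qed

text \<open>Degrees in one variable add up, so every divisor of a nonzero polynomial only involves its variables.\<close>

lemma pols_factor:
  fixes a b :: "('x, 'a::field) mpol"
  assumes "a * b \<in> pols X" "a * b \<noteq> 0"
  shows "a \<in> pols X"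
  unfolding pols_iff_deg_lt
proof (intro allI impI)
  fix y assume "y \<notin> X"
  with assms(1) have ab: "deg_lt y 1 (a * b)"
    by (simp add: pols_iff_deg_lt)
  have "a \<noteq> 0" "b \<noteq> 0"
    using assms(2) by auto
  obtain m a0 a1 where a: "a = a0 * xpow y m + a1" "a0 \<noteq> 0" "a0 \<in> pols (UNIV - {y})"
    "deg_lt y m a1" "deg_lt y (Suc m) a"
    using split_lead_coeff[OF pols_UNIV \<open>a \<noteq> 0\<close>, of y] by blast
  obtain n b0 b1 where b: "b = b0 * xpow y n + b1" "b0 \<noteq> 0" "b0 \<in> pols (UNIV - {y})"
    "deg_lt y n b1" "deg_lt y (Suc n) b"
    using split_lead_coeff[OF pols_UNIV \<open>b \<noteq> 0\<close>, of y] by blast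
  have "m + n = 0"
  proof (rule ccontr)
    assume "m + n \<noteq> 0"
    have "deg_lt y (m + n) (a0 * xpow y m * b1)"
      by (intro deg_lt_mult[OF _ b(4)] deg_lt_mult_pols[OF a(3)] deg_lt_xpow) simp
    moreover have "deg_lt y (m + n) (a1 * b)"
      using deg_lt_mult[OF b(5) a(4)] by (simp add: mult.commute add.commute)
    moreover have "deg_lt y (m + n) (a * b)"
      using deg_lt_mono[OF ab, of "m + n"] \<open>m + n \<noteq> 0\<close> by simp
    ultimately have "deg_lt y (m + n) (a0 * xpow y m * b1 + a1 * b - a * b)"
      by (intro deg_lt_diff deg_lt_add)
    moreover have "a * b = a0 * xpow y m * b + a1 * b"
      by (simp add: a(1) algebra_simps)
    then have "a0 * b0 * xpow y (m + n) + (a0 * xpow y m * b1 + a1 * b - a * b) = 0"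
      by (simp add: b(1) xpow_add algebra_simps)
    moreover have "a0 * b0 \<in> pols (- {y})"
      using a(3) b(3) by (simp add: pols_mult Compl_eq_Diff_UNIV)
    ultimately have "a0 * b0 = 0"
      using top_coeff_eq_0 by blast
    then show False
      using mpol_no_zero_divisors a(2) b(2) by blast
  qed
  then show "deg_lt y 1 a"
    using a(5) by simp
qed

end

section \<open>Unique factorization of polynomials\<close>

text \<open>
  Primality is tested on products in the variables \<open>X\<close> only, since unique factorization is
  established by induction on the set of variables. Divisibility may still be taken in the
  whole ring: by \<open>pols_factor\<close>, cofactors of nonzero polynomials bring in no further variables.
\<close>

definition prime_in :: "'x set \<Rightarrow> ('x, 'a::comm_ring_1) mpol \<Rightarrow> bool" where
  "prime_in X p \<longleftrightarrow> (\<forall>f\<in>pols X. \<forall>g\<in>pols X. p dvd f * g \<longrightarrow> p dvd f \<or> p dvd g)"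

lemma prime_inD: "prime_in X p \<Longrightarrow> f \<in> pols X \<Longrightarrow> g \<in> pols X \<Longrightarrow> p dvd f * g \<Longrightarrow> p dvd f \<or> p dvd g"
  by (simp add: prime_in_def)

context term_order
begin

text \<open>
  Let \<open>k\<close> be the cofactor of \<open>p\<close>. If its degree in \<open>x\<close> exceeded \<open>n\<close>, the top coefficient
  of \<open>p * k\<close> would be a nonzero product that nothing else can cancel. So \<open>k\<close> has degree at
  most \<open>n\<close>, and the coefficients can be compared.
\<close>

lemma dvd_coeffs:
  fixes p :: "('x, 'a::field) mpol"
  assumes p: "p \<in> pols (- {x})" "p \<noteq> 0"
    and a: "a \<in> pols (- {x})" and f: "deg_lt x n f"
    and dvd: "p dvd a * xpow x n + f"
  shows "p dvd a \<and> p dvd f"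
proof -
  obtain k where k: "a * xpow x n + f = p * k"
    using dvd by blast
  show ?thesis
  proof (cases "k = 0")
    case True
    then show ?thesis
      using top_coeff_eq_0[OF a f] k by simp
  next
    case False
    then obtain N c k' where k': "k = c * xpow x N + k'" "c \<noteq> 0" "c \<in> pols (- {x})"
      "deg_lt x N k'" "deg_lt x (Suc N) k"
      using split_lead_coeff[OF pols_UNIV False, of x, folded Compl_eq_Diff_UNIV] by blast
    have pc: "p * c \<in> pols (- {x})"
      by (intro pols_mult p k')
    have pk': "deg_lt x N (p * k')" and pk: "deg_lt x (Suc N) (p * k)"
      using deg_lt_mult_pols[OF p(1)] k' by auto
    consider "N > n" | "N = n" | "N < n"
      by linarith
    then show ?thesis
    proof cases
      case 1
      have "deg_lt x N (a * xpow x n + f)"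
        using deg_lt_mult_pols[OF a _ deg_lt_xpow, of x n] f 1
        by (intro deg_lt_add) (auto intro: deg_lt_mono)
      with pk' have "deg_lt x N (p * k' - (a * xpow x n + f))"
        by (rule deg_lt_diff)
      moreover have "p * c * xpow x N + (p * k' - (a * xpow x n + f)) = 0"
        unfolding k by (simp add: k'(1) algebra_simps)
      ultimately show ?thesis
        using top_coeff_eq_0[OF pc] mpol_no_zero_divisors[OF p(2) k'(2)] by blast
    next
      case 2
      have "(a - p * c) * xpow x n + (f - p * k') = 0"
        using k by (simp add: k'(1) 2 algebra_simps)
      moreover have "deg_lt x n (f - p * k')"
        using f pk' 2 by (intro deg_lt_diff) simp_all
      ultimately have "a - p * c = 0 \<and> f - p * k' = 0"
        using top_coeff_eq_0[OF pols_diff[OF a pc]] by blast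
      then show ?thesis
        by auto
    next
      case 3
      have "a * xpow x n + (f - p * k) = 0"
        using k by (simp add: algebra_simps)
      moreover have "deg_lt x n (f - p * k)"
        using f pk 3 by (intro deg_lt_diff) (auto intro: deg_lt_mono)
      ultimately have "a = 0 \<and> f - p * k = 0"
        using top_coeff_eq_0[OF a] by blast
      then show ?thesis
        by auto
    qed
  qed
qed

text \<open>
  Gauss's lemma. If \<open>p\<close> divides \<open>f * g\<close>, it divides the product of the top coefficients in
  \<open>x\<close>, hence one of them; the corresponding top summand may then be dropped from \<open>f\<close> or \<open>g\<close>.
\<close>

lemma Gauss_prime_in_insert:
  fixes p :: "('x, 'a::field) mpol"
  assumes p: "p \<in> pols X" "p \<noteq> 0" "prime_in X p" and x: "x \<notin> X"
  shows "prime_in (insert x X) p"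
proof -
  have X: "insert x X - {x} = X" and p': "p \<in> pols (- {x})"
    and sub: "\<And>a :: ('x, 'a) mpol. a \<in> pols X \<Longrightarrow> a \<in> pols (- {x})"
    using x p(1) pols_mono[of _ X "- {x}"] by auto
  have "p dvd f \<or> p dvd g"
    if "deg_lt x m f" "deg_lt x n g" "f \<in> pols (insert x X)" "g \<in> pols (insert x X)" "p dvd f * g"
    for m n f g
    using that
  proof (induction "m + n" arbitrary: m n f g rule: less_induct)
    case less
    show ?case
    proof (cases "m = 0 \<or> n = 0")
      case True
      then show ?thesis
        using less.prems by (auto simp: deg_lt_0_iff)
    next
      case False
      then obtain m' n' where mn: "m = Suc m'" "n = Suc n'"
        by (metis not0_implies_Suc)
      obtain a f' where f: "f = a * xpow x m' + f'" "a \<in> pols X" "f' \<in> pols (insert x X)" "deg_lt x m' f'"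
        using split_top_coeff[OF less.prems(3)] less.prems(1) mn X by metis
      obtain b g' where g: "g = b * xpow x n' + g'" "b \<in> pols X" "g' \<in> pols (insert x X)" "deg_lt x n' g'"
        using split_top_coeff[OF less.prems(4)] less.prems(2) mn X by metis
      have "deg_lt x (m' + n') (a * xpow x m' * g')"
        by (intro deg_lt_mult[OF _ g(4)] deg_lt_mult_pols[OF f(2) x] deg_lt_xpow)
      moreover have "deg_lt x (m' + n') (f' * g)"
        using deg_lt_mult[OF less.prems(2)[unfolded mn] f(4)] by (simp add: mult.commute add.commute)
      ultimately have low: "deg_lt x (m' + n') (a * xpow x m' * g' + f' * g)"
        by (rule deg_lt_add)
      have "f * g = a * b * xpow x (m' + n') + (a * xpow x m' * g' + f' * g)"
        by (subst f(1)) (simp add: g(1) xpow_add algebra_simps)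
      then have "p dvd a * b"
        using dvd_coeffs[OF p' p(2) _ low] less.prems(5) pols_mult[OF sub[OF f(2)] sub[OF g(2)]] by auto
      then consider "p dvd a" | "p dvd b"
        using prime_inD[OF p(3)] f(2) g(2) by blast
      then show ?thesis
      proof cases
        case 1
        have "f' * g = f * g - a * (xpow x m' * g)"
          by (simp add: f(1) algebra_simps)
        then have "p dvd f' * g"
          using 1 less.prems(5) by simp
        then have "p dvd f' \<or> p dvd g"
          using less.hyps[of m' n f' g] mn f less.prems by simp
        then show ?thesis
          using 1 by (auto simp: f(1))
      next
        case 2
        have "f * g' = f * g - b * (xpow x n' * f)"
          by (simp add: g(1) algebra_simps)
        then have "p dvd f * g'"
          using 2 less.prems(5) by simp
        then have "p dvd f \<or> p dvd g'"
          using less.hyps[of m n' f g'] mn g less.prems by simp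
        then show ?thesis
          using 2 by (auto simp: g(1))
      qed
    qed
  qed
  then show ?thesis
    unfolding prime_in_def by (meson deg_lt_ex)
qed

lemma lead_0_imp_unit:
  fixes p :: "('x, 'a::field) mpol"
  assumes "lead p 0"
  shows "p dvd 1"
proof -
  have "Poly_Mapping.keys p = {0}"
    using assms zero_preceq prec_asym unfolding lead_def by blast
  then have "p = Poly_Mapping.single 0 (Poly_Mapping.lookup p 0)" "Poly_Mapping.lookup p 0 \<noteq> 0"
    using sum_monomials[of p] by (auto simp: in_keys_iff)
  then have "p * Poly_Mapping.single 0 (inverse (Poly_Mapping.lookup p 0)) = 1"
    by (metis mult_single add_0 right_inverse single_one)
  then show ?thesis
    by (metis dvd_triv_left)
qed

text \<open>
  Both factors in a proper factorization have smaller leading terms, so that the well-foundedness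
  of the ordering gives the existence of factorizations into irreducible polynomials.
\<close>

lemma factor_induct [consumes 1, case_names unit irreducible mult]:
  fixes s :: "('x, 'a::field) mpol"
  assumes "s \<noteq> 0"
    and unit: "\<And>u. u dvd 1 \<Longrightarrow> P u"
    and irred: "\<And>p. irreducible p \<Longrightarrow> P p"
    and mult: "\<And>a b. a \<noteq> 0 \<Longrightarrow> b \<noteq> 0 \<Longrightarrow> P a \<Longrightarrow> P b \<Longrightarrow> P (a * b)"
  shows "P s"
proof -
  have "P s" if "lead s t" for s t
    using that
  proof (induction t arbitrary: s rule: wfp_induct_rule[OF wf_prec])
    case (1 t)
    show ?case
    proof (cases "s dvd 1 \<or> irreducible s")
      case False
      then obtain a b where ab: "s = a * b" "\<not> a dvd 1" "\<not> b dvd 1"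
        using lead_nonzero[OF 1(2)] unfolding irreducible_def by blast
      then have nz: "a \<noteq> 0" "b \<noteq> 0"
        using lead_nonzero[OF 1(2)] by auto
      then obtain u v where uv: "lead a u" "lead b v"
        using lead_lead_term by blast
      then have "t = u + v"
        using lead_mult[OF uv] lead_unique 1(2) ab(1) by blast
      moreover have "0 \<prec> u" "0 \<prec> v"
        using zero_preceq lead_0_imp_unit uv ab by metis+
      ultimately have "u \<prec> t" "v \<prec> t"
        using add_right_mono[of 0 u v] add_left_mono[of 0 v u] by auto
      then show ?thesis
        unfolding ab(1) using 1(1) uv nz by (intro mult) auto
    qed (use unit[of s] irred[of s] in auto)
  qed
  then show ?thesis
    using lead_lead_term assms(1) by blast
qed

text \<open>
  Coefficients cannot be divided by the top coefficient \<open>c\<close> of \<open>r\<close>, so \<open>f\<close> is multiplied by \<open>c\<close>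
  before each step instead.
\<close>

lemma pseudo_division:
  fixes r :: "('x, 'a::field) mpol"
  assumes x: "x \<notin> X"
    and r: "r = c * xpow x k + r'" "c \<noteq> 0" "c \<in> pols X" "r' \<in> pols (insert x X)" "deg_lt x k r'"
    and f: "f \<in> pols (insert x X)"
  obtains s q where "s \<in> pols X" "s \<noteq> 0" "q \<in> pols (insert x X)" "deg_lt x k (s * f - q * r)"
proof -
  have X: "insert x X - {x} = X"
    using x by auto
  have up: "a \<in> pols (insert x X)" if "a \<in> pols X" for a :: "('x, 'a) mpol"
    using that pols_mono by blast
  have "\<exists>s\<in>pols X. s \<noteq> 0 \<and> (\<exists>q\<in>pols (insert x X). deg_lt x k (s * f - q * r))"
    if "deg_lt x n f" "f \<in> pols (insert x X)" for n f
    using that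
  proof (induction n arbitrary: f)
    case 0
    then show ?case
      by (intro bexI[of _ 1] conjI bexI[of _ 0]) (auto simp: deg_lt_0_iff)
  next
    case (Suc n)
    show ?case
    proof (cases "n < k")
      case True
      then show ?thesis
        using deg_lt_mono[OF Suc.prems(1)] by (intro bexI[of _ 1] conjI bexI[of _ 0]) auto
    next
      case False
      obtain a f' where f: "f = a * xpow x n + f'" "a \<in> pols X" "f' \<in> pols (insert x X)" "deg_lt x n f'"
        using split_top_coeff[OF Suc.prems(2,1)] X by metis
      let ?q = "a * xpow x (n - k)"
      have q: "?q \<in> pols (insert x X)"
        by (intro pols_mult up f xpow_in_pols) simp
      have "xpow x n = xpow x (n - k) * (xpow x k :: ('x, 'a) mpol)"
        using False by (simp flip: xpow_add)
      then have eq: "c * f - ?q * r = c * f' - ?q * r'"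
        by (simp add: f(1) r(1) algebra_simps)
      have "deg_lt x (n - k + k) (?q * r')"
        by (intro deg_lt_mult[OF _ r(5)] deg_lt_mult_pols[OF f(2) x] deg_lt_xpow)
      then have "deg_lt x n (c * f - ?q * r)"
        unfolding eq using False deg_lt_mult_pols[OF r(3) x f(4)] by (intro deg_lt_diff) simp_all
      moreover have "c * f - ?q * r \<in> pols (insert x X)"
        unfolding eq by (intro pols_diff pols_mult q up r f)
      ultimately obtain s q' where s: "s \<in> pols X" "s \<noteq> 0" "q' \<in> pols (insert x X)"
        "deg_lt x k (s * (c * f - ?q * r) - q' * r)"
        using Suc.IH by blast
      have "s * (c * f - ?q * r) - q' * r = (s * c) * f - (s * ?q + q') * r"
        by (simp add: algebra_simps)
      then have "deg_lt x k ((s * c) * f - (s * ?q + q') * r)"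
        using s(4) by simp
      moreover have "s * c \<in> pols X" "s * c \<noteq> 0" "s * ?q + q' \<in> pols (insert x X)"
        using s r mpol_no_zero_divisors q up by (auto intro!: pols_mult pols_add)
      ultimately show ?thesis
        by blast
    qed
  qed
  moreover obtain n where "deg_lt x n f"
    using deg_lt_ex[of x f] by blast
  ultimately show ?thesis
    using that f by blast
qed

text \<open>
  Every irreducible factor of \<open>s\<close> is prime, so it divides \<open>q\<close> or \<open>r\<close> and can be cancelled
  from there.
\<close>

lemma split_factorization:
  fixes s :: "('x, 'a::field) mpol"
  assumes prime: "\<And>p :: ('x, 'a) mpol. p \<in> pols X \<Longrightarrow> irreducible p \<Longrightarrow> prime_in Y p"
    and "s \<noteq> 0" "s \<in> pols X" "s * f = q * r" "q \<in> pols Y" "r \<in> pols Y"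
  shows "\<exists>s1 s2 q' r'. s = s1 * s2 \<and> q = s1 * q' \<and> r = s2 * r' \<and> f = q' * r'"
  using assms(2-)
proof (induction s arbitrary: f q r rule: factor_induct)
  case (unit u)
  then obtain v where v: "1 = u * v"
    by blast
  have inv: "w = v * (u * w)" "w = u * (v * w)" for w
    by (metis v mult.assoc mult.commute mult_1)+
  have "f = (v * q) * r"
    using inv(1)[of f] unit.prems(2) by (simp add: mult.assoc)
  moreover have "q = u * (v * q)"
    by (rule inv(2))
  ultimately show ?case
    by (intro exI[of _ u] exI[of _ 1] exI[of _ "v * q"] exI[of _ r]) simp
next
  case (irreducible p)
  then have nz: "p \<noteq> 0"
    by auto
  have "p dvd q * r"
    using irreducible by (metis dvd_triv_left)
  then consider q' where "q = p * q'" | r' where "r = p * r'"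
    using prime_inD[OF prime] irreducible by blast
  then show ?case
  proof cases
    case 1
    then have "f = q' * r"
      using mpol_mult_left_cancel[OF nz, of f "q' * r"] irreducible by (simp add: mult.assoc)
    then show ?thesis
      using 1 by (intro exI[of _ p] exI[of _ 1] exI[of _ q'] exI[of _ r]) simp
  next
    case 2
    then have "f = q * r'"
      using mpol_mult_left_cancel[OF nz, of f "q * r'"] irreducible by (simp add: mult.left_commute)
    then show ?thesis
      using 2 by (intro exI[of _ 1] exI[of _ p] exI[of _ q] exI[of _ r']) simp
  qed
next
  case (mult a b)
  have ab: "a \<in> pols X" "b \<in> pols X"
    using pols_factor[of a b X] pols_factor[of b a X] mult.prems(1) mpol_no_zero_divisors[OF mult.hyps]
    by (simp_all add: mult.commute)
  have "a * (b * f) = q * r"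
    using mult.prems by (simp add: mult.assoc)
  then obtain s1 s2 q' r' where 1: "a = s1 * s2" "q = s1 * q'" "r = s2 * r'" "b * f = q' * r'"
    using mult.IH(1)[OF ab(1)] mult.prems by blast
  have fac: "v \<in> pols Y" if "u * v \<in> pols Y" "u \<noteq> 0" for u v :: "('x, 'a) mpol"
    using that pols_factor[of v u Y] by (cases "v = 0") (auto simp: mult.commute dest: mpol_no_zero_divisors)
  have s12: "s1 \<noteq> 0" "s2 \<noteq> 0"
    using mult.hyps(1) 1(1) by auto
  have "q' \<in> pols Y" "r' \<in> pols Y"
    using fac[of s1 q'] fac[of s2 r'] mult.prems(3,4) 1(2,3) s12 by auto
  then obtain t1 t2 q'' r'' where "b = t1 * t2" "q' = t1 * q''" "r' = t2 * r''" "f = q'' * r''"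
    using mult.IH(2)[OF ab(2) 1(4)] by blast
  with 1 show ?case
    by (intro exI[of _ "s1 * t1"] exI[of _ "s2 * t2"] exI[of _ q''] exI[of _ r'']) (simp add: ac_simps)
qed

text \<open>
  No irreducible factor of \<open>s\<close> divides \<open>f\<close>: it would be \<open>f\<close> up to a unit, but \<open>f\<close> involves a
  variable outside \<open>X\<close>. So these factors divide the cofactor of \<open>f\<close> and can be cancelled.
\<close>

lemma irreducible_dvd_cancel:
  fixes f :: "('x, 'a::field) mpol"
  assumes prime: "\<And>p :: ('x, 'a) mpol. p \<in> pols X \<Longrightarrow> irreducible p \<Longrightarrow> prime_in Y p"
    and f: "irreducible f" "f \<in> pols Y" "f \<notin> pols X"
    and sub: "X \<subseteq> Y"
    and "s \<noteq> 0" "s \<in> pols X" "g \<in> pols Y" "f dvd s * g"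
  shows "f dvd g"
  using assms(6-)
proof (induction s arbitrary: g rule: factor_induct)
  case (unit u)
  then obtain v k where v: "1 = u * v" and k: "u * g = f * k"
    by (auto simp: dvd_def)
  have "g = v * (u * g)"
    by (metis v mult.assoc mult.commute mult_1)
  then show ?case
    unfolding k by (metis dvd_triv_left mult.left_commute)
next
  case (irreducible p)
  then have nz: "p \<noteq> 0"
    by auto
  obtain k where k: "p * g = f * k"
    using irreducible.prems by blast
  have "p * g \<in> pols Y"
    using irreducible.prems sub pols_mono pols_mult by blast
  moreover have "f \<noteq> 0"
    using f(1) by auto
  ultimately have "k \<in> pols Y"
    using k pols_factor[of k f Y] mpol_no_zero_divisors[of k f]
    by (cases "k = 0") (auto simp: mult.commute)
  then have "p dvd f \<or> p dvd k"
    using prime_inD[OF prime[OF irreducible.prems(1) irreducible.hyps] f(2)] k by (metis dvd_triv_left)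
  moreover have "\<not> p dvd f"
  proof
    assume "p dvd f"
    then obtain u where u: "f = p * u"
      by blast
    then have "u dvd 1"
      using f(1) irreducible.hyps by (auto simp: irreducible_def)
    then obtain v where "1 = u * v"
      by blast
    then have "p = f * v"
      using u by (simp add: mult.assoc)
    then have "f \<in> pols X"
      using pols_factor[of f v X] irreducible.prems(1) nz by simp
    with f(3) show False ..
  qed
  ultimately obtain k' where "k = p * k'"
    by blast
  then have "p * g = p * (f * k')"
    using k by (simp add: mult.left_commute)
  then have "g = f * k'"
    by (rule mpol_mult_left_cancel[OF nz])
  then show ?case
    by simp
next
  case (mult a b)
  have ab: "a \<in> pols X" "b \<in> pols X"
    using pols_factor[of a b X] pols_factor[of b a X] mult.prems(1) mpol_no_zero_divisors[OF mult.hyps]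
    by (simp_all add: mult.commute)
  then have "b * g \<in> pols Y"
    using mult.prems(2) sub pols_mono pols_mult by blast
  moreover have "f dvd a * (b * g)"
    using mult.prems(3) by (simp add: mult.assoc)
  ultimately show ?case
    using mult.IH ab mult.prems(2) by blast
qed

text \<open>
  Unique factorization, by induction on the set of variables. Let the irreducible \<open>f\<close> involve the new
  variable \<open>x\<close>, and let it divide \<open>g * h\<close>. As over a field of fractions, take a
  polynomial \<open>r\<close> of least degree in \<open>x\<close> in the ideal of \<open>f\<close> and \<open>g\<close>. By pseudo-division, some
  multiples \<open>s * f\<close> and \<open>s' * g\<close>, with \<open>s\<close> and \<open>s'\<close> free of \<open>x\<close>, are multiples of \<open>r\<close>.
  Distributing the prime factors of \<open>s\<close> turns the factorization of \<open>s * f\<close> into a factorization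
  of \<open>f\<close>, one factor of which is a unit. So \<open>r\<close> is, up to a factor free of \<open>x\<close>, either \<open>f\<close>
  or a unit; in the first case \<open>f\<close> divides \<open>g\<close>, in the second case it divides \<open>h\<close>.
\<close>

lemma irreducible_prime_in:
  fixes f :: "('x, 'a::field) mpol"
  assumes "finite X" "f \<in> pols X" "irreducible f"
  shows "prime_in X f"
  using assms
proof (induction X arbitrary: f)
  case empty
  then have f: "f \<noteq> 0"
    by auto
  with empty(1) have "lead_term (\<prec>) f = 0"
    using lead_lead_term[OF f] by (auto simp: pols_def lead_def)
  then have "lead f 0"
    using lead_lead_term[OF f] by simp
  then show ?case
    using lead_0_imp_unit[of f] empty(2) by (simp add: irreducible_def)
next
  case (insert x X)
  let ?Y = "insert x X"
  have prime: "prime_in ?Y p" if "p \<in> pols X" "irreducible p" for p :: "('x, 'a) mpol"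
  proof -
    have "p \<noteq> 0"
      using that(2) by auto
    then show ?thesis
      using Gauss_prime_in_insert that insert.IH[OF that] insert.hyps(2) by blast
  qed
  have up: "a \<in> pols ?Y" if "a \<in> pols X" for a :: "('x, 'a) mpol"
    using that pols_mono by blast
  have X: "?Y - {x} = X"
    using insert.hyps by auto
  show ?case
  proof (cases "f \<in> pols X")
    case True
    then show ?thesis
      using prime insert.prems by blast
  next
    case False
    have cancel: "f dvd w" if "s \<noteq> 0" "s \<in> pols X" "w \<in> pols ?Y" "f dvd s * w" for s w
      by (rule irreducible_dvd_cancel[OF _ insert.prems(2,1) False subset_insertI that]) (rule prime)
    show ?thesis
      unfolding prime_in_def
    proof (intro ballI impI)
      fix g h :: "('x, 'a) mpol"
      assume g: "g \<in> pols ?Y" and h: "h \<in> pols ?Y" and fgh: "f dvd g * h"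
      \<comment> \<open>The ideal generated by \<open>f\<close> and \<open>g\<close> in the polynomials over \<open>?Y\<close>.\<close>
      define I where "I = {a * f + b * g | a b. a \<in> pols ?Y \<and> b \<in> pols ?Y}"
      have fI: "f \<in> I" and gI: "g \<in> I"
        unfolding I_def
        using zero_in_pols one_in_pols by (metis (mono_tags, lifting) mem_Collect_eq mult_1 mult_zero_left add_0 add_0_right)+
      define n where "n = (LEAST n. \<exists>r\<in>I. r \<noteq> 0 \<and> deg_lt x n r)"
      have "\<exists>n. \<exists>r\<in>I. r \<noteq> 0 \<and> deg_lt x n r"
        using fI insert.prems(2) deg_lt_ex by (metis not_irreducible_zero)
      then have "\<exists>r\<in>I. r \<noteq> 0 \<and> deg_lt x n r"
        unfolding n_def by (rule LeastI_ex)
      then obtain r where r: "r \<in> I" "r \<noteq> 0" "deg_lt x n r"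
        by blast
      have rY: "r \<in> pols ?Y"
        using r(1) g insert.prems unfolding I_def by (auto intro!: pols_add pols_mult)
      obtain k c r' where k: "r = c * xpow x k + r'" "c \<noteq> 0" "c \<in> pols X" "r' \<in> pols ?Y" "deg_lt x k r'"
        using split_lead_coeff[OF rY r(2), of x] X by metis
      have "k < n"
      proof (rule ccontr)
        assume "\<not> k < n"
        then have "deg_lt x k (r' - r)"
          using k(5) r(3) by (intro deg_lt_diff) (auto intro: deg_lt_mono)
        moreover have "c * xpow x k + (r' - r) = 0"
          by (simp add: k(1))
        ultimately show False
          using top_coeff_eq_0 k(2) pols_mono[OF k(3), of "- {x}"] insert.hyps(2) by blast
      qed
      have multiple: "\<exists>s q. s \<in> pols X \<and> s \<noteq> 0 \<and> q \<in> pols ?Y \<and> s * w = q * r" if "w \<in> I" for w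
      proof -
        have "w \<in> pols ?Y"
          using that g insert.prems unfolding I_def by (auto intro!: pols_add pols_mult)
        then obtain s q where s: "s \<in> pols X" "s \<noteq> 0" "q \<in> pols ?Y" "deg_lt x k (s * w - q * r)"
          using pseudo_division[OF insert.hyps(2) k] by blast
        obtain a b a' b' where ab: "w = a * f + b * g" "r = a' * f + b' * g"
          "a \<in> pols ?Y" "b \<in> pols ?Y" "a' \<in> pols ?Y" "b' \<in> pols ?Y"
          using \<open>w \<in> I\<close> r(1) unfolding I_def by blast
        have "s * w - q * r = (s * a - q * a') * f + (s * b - q * b') * g"
          by (simp add: ab algebra_simps)
        then have "s * w - q * r \<in> I"
          unfolding I_def using ab s up by (blast intro: pols_diff pols_mult)
        then have "s * w - q * r = 0"
          using not_less_Least[of k "\<lambda>n. \<exists>r\<in>I. r \<noteq> 0 \<and> deg_lt x n r"] \<open>k < n\<close> s(4) unfolding n_def by blast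
        with s show ?thesis
          by auto
      qed
      obtain s q where s: "s \<in> pols X" "s \<noteq> 0" "q \<in> pols ?Y" "s * f = q * r"
        using multiple[OF fI] by blast
      obtain s' q' where s': "s' \<in> pols X" "s' \<noteq> 0" "q' \<in> pols ?Y" "s' * g = q' * r"
        using multiple[OF gI] by blast
      obtain s1 s2 q0 r0 where sp: "s = s1 * s2" "q = s1 * q0" "r = s2 * r0" "f = q0 * r0"
        using split_factorization[OF prime s(2,1,4,3) rY] by blast
      have "q0 dvd 1 \<or> r0 dvd 1"
        using insert.prems(2) sp(4) by (auto simp: irreducible_def)
      then show "f dvd g \<or> f dvd h"
      proof
        assume "q0 dvd 1"
        then obtain v where "1 = q0 * v"
          by blast
        moreover have "f * v = (q0 * v) * r0"
          by (simp add: sp(4) ac_simps)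
        ultimately have "r0 = f * v"
          by (metis mult_1)
        then have "f dvd s' * g"
          using s'(4) sp(3) by simp
        then show ?thesis
          using cancel[OF s'(2,1) g] by blast
      next
        assume "r0 dvd 1"
        then obtain v where v: "1 = r0 * v"
          by blast
        then have "s2 = r * v"
          using sp(3) by (simp add: mult.assoc)
        have s2: "s2 \<in> pols X" "s2 \<noteq> 0"
          using s sp(1) pols_factor[of s2 s1 X] by (auto simp: mult.commute)
        obtain a b where "r = a * f + b * g"
          using r(1) unfolding I_def by blast
        then have "r * h = f * (a * h) + b * (g * h)"
          by (simp add: algebra_simps)
        then have "f dvd r * h"
          using fgh by simp
        then have "f dvd s2 * h"
          unfolding \<open>s2 = r * v\<close> by (metis dvd_mult mult.commute mult.left_commute)
        then show ?thesis
          using cancel[OF s2(2,1) h] by blast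
      qed
    qed
  qed
qed

text \<open>
  The fraction \<open>f / g\<close> in lowest terms \<open>a / b\<close>. Coprimality of \<open>a\<close> and \<open>b\<close> takes the form of
  Euclid's lemma, as it is this form that transfers divisibility to other fractions equal to \<open>a / b\<close>.
\<close>

lemma ex_coprime_quotients:
  fixes f g :: "('x, 'a::field) mpol"
  assumes "g \<noteq> 0"
  shows "\<exists>d a b. f = d * a \<and> g = d * b \<and> (\<forall>h. b dvd a * h \<longrightarrow> b dvd h)"
  using assms
proof (induction g arbitrary: f rule: factor_induct)
  case (unit u)
  then have "u dvd h" for h
    by (meson dvd_trans one_dvd)
  then show ?case
    by (intro exI[of _ 1] exI[of _ f] exI[of _ u]) simp
next
  case (irreducible p)
  show ?case
  proof (cases "p dvd f")
    case True
    then obtain a where "f = p * a"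
      by blast
    then show ?thesis
      by (intro exI[of _ p] exI[of _ a] exI[of _ 1]) simp
  next
    case False
    have "prime_in UNIV p"
      by (rule irreducible_prime_in[OF finite pols_UNIV irreducible])
    then have "p dvd h" if "p dvd f * h" for h
      using prime_inD[OF _ pols_UNIV pols_UNIV that] False by blast
    moreover have "f = 1 * f" "p = 1 * p"
      by simp_all
    ultimately show ?thesis
      by blast
  qed
next
  case (mult g1 g2)
  obtain d a b where 1: "f = d * a" "g1 = d * b" "\<And>h. b dvd a * h \<Longrightarrow> b dvd h"
    using mult.IH(1) by blast
  obtain d' a' b' where 2: "a = d' * a'" "g2 = d' * b'" "\<And>h. b' dvd a' * h \<Longrightarrow> b' dvd h"
    using mult.IH(2) by blast
  have "b * b' dvd h" if h: "b * b' dvd a' * h" for h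
  proof -
    have "b' dvd h"
      using 2(3) h dvd_mult_right by blast
    then obtain h' where h': "h = b' * h'"
      by blast
    have "b' \<noteq> 0"
      using mult.hyps 2(2) by auto
    have "b' * b dvd b' * (a' * h')"
      using h by (simp add: h' ac_simps)
    then have "b dvd a' * h'"
      using mpol_mult_left_cancel[OF \<open>b' \<noteq> 0\<close>] by (auto simp: dvd_def mult.assoc)
    then have "b dvd a * h'"
      unfolding 2(1) by (metis dvd_mult mult.assoc)
    then have "b dvd h'"
      by (rule 1(3))
    then show ?thesis
      unfolding h' by (simp add: mult.commute mult_dvd_mono)
  qed
  moreover have "f = (d * d') * a'" "g1 * g2 = (d * d') * (b * b')"
    unfolding 1(1,2) 2(1,2) by (simp_all add: ac_simps)
  ultimately show ?case
    by blast
qed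

end

section \<open>Ideals and leading terms\<close>

lemma ideal_of_diff: "p \<in> ideal_of B \<Longrightarrow> q \<in> ideal_of B \<Longrightarrow> p - q \<in> ideal_of B"
  unfolding ideal_of_def by (rule module.span_diff[OF module_mpol])

lemma ideal_of_mult: "g \<in> B \<Longrightarrow> q * g \<in> ideal_of B"
  unfolding ideal_of_def
  by (intro module.span_scale[OF module_mpol] module.span_base[OF module_mpol])

definition combinations :: "(nat \<Rightarrow> ('x, 'a::comm_ring_1) mpol) \<Rightarrow> nat \<Rightarrow> ('x, 'a) mpol set" where
  "combinations g m = {\<Sum>i<m. h i * g i | h. True}"

lemma combinations_add: "p \<in> combinations g m \<Longrightarrow> q \<in> combinations g m \<Longrightarrow> p + q \<in> combinations g m"
  unfolding combinations_def by (fastforce simp: sum.distrib[symmetric] distrib_right[symmetric])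

lemma combinations_mult: "p \<in> combinations g m \<Longrightarrow> q * p \<in> combinations g m"
  unfolding combinations_def by (fastforce simp: sum_distrib_left mult.assoc[symmetric])

lemma combinations_zero: "0 \<in> combinations g m"
  unfolding combinations_def by (auto intro!: exI[of _ "\<lambda>_. 0"])

lemma combinations_generator:
  assumes "i < m"
  shows "g i \<in> combinations g m"
proof -
  have "(\<Sum>j<m. (if j = i then 1 else 0) * g j) = (\<Sum>j<m. if j = i then g j else 0)"
    by (intro sum.cong) auto
  also have "\<dots> = g i"
    using assms by simp
  finally show ?thesis
    unfolding combinations_def by (auto intro!: exI[of _ "\<lambda>j. if j = i then 1 else 0"])
qed

lemma ideal_of_subset_combinations:
  fixes G :: "('x, 'a::comm_ring_1) mpol list"
  shows "ideal_of (set G) \<subseteq> combinations (\<lambda>i. G ! i) (length G)"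
  unfolding ideal_of_def
proof (rule module.span_minimal[OF module_mpol])
  show "set G \<subseteq> combinations (\<lambda>i. G ! i) (length G)"
    using combinations_generator[of _ "length G" "\<lambda>i. G ! i"] by (auto simp: in_set_conv_nth)
  show "module.subspace (*) (combinations (\<lambda>i. G ! i) (length G))"
    by (intro module.subspaceI[OF module_mpol] combinations_zero combinations_add combinations_mult)
qed

lemma S_poly_in_ideal: "f \<in> B \<Longrightarrow> g \<in> B \<Longrightarrow> S_poly prec f g \<in> ideal_of B"
  unfolding S_poly_def by (intro ideal_of_diff ideal_of_mult)

context term_order
begin

lemma cancel_lead:
  fixes p g :: "('x, 'a::field) mpol"
  assumes p: "lead p t" and g: "lead g u" and "pp_dvd u t"
  obtains c where "c \<noteq> 0" "below (p - Poly_Mapping.single (t - u) c * g) 0 t"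
proof -
  obtain a p' where p': "a \<noteq> 0" "p = Poly_Mapping.single t a + p'" "below p' 0 t"
    using lead_decompose[OF p] by blast
  obtain b g' where g': "b \<noteq> 0" "g = Poly_Mapping.single u b + g'" "below g' 0 u"
    using lead_decompose[OF g] by blast
  have t: "t - u + u = t"
    using assms(3) by (rule pp_dvd_add_minus)
  have "Poly_Mapping.single (t - u) (a / b) * Poly_Mapping.single u b = Poly_Mapping.single t a"
    using g'(1) t by (simp add: mult_single)
  then have "p - Poly_Mapping.single (t - u) (a / b) * g = p' - Poly_Mapping.single (t - u) (a / b) * g'"
    by (simp add: p'(2) g'(2) algebra_simps)
  moreover have "below (Poly_Mapping.single (t - u) (a / b) * g') 0 t"
    using below_mult_left[OF lead_single g'(3), of "a / b" "t - u"] p'(1) g'(1) t by simp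
  ultimately have "below (p - Poly_Mapping.single (t - u) (a / b) * g) 0 t"
    using below_diff[OF p'(3)] by simp
  then show ?thesis
    using that[of "a / b"] p'(1) g'(1) by simp
qed

lemma below_lead: "below p 0 u \<Longrightarrow> lead p t \<Longrightarrow> t \<prec> u"
  by (simp add: below_def lead_def)

lemma head_reduction:
  fixes g :: "nat \<Rightarrow> ('x, 'a::field) mpol"
  assumes g: "\<And>i. i < m \<Longrightarrow> lead (g i) (l i)"
  obtains q r where "h = q + r" "q \<in> combinations g m"
    "r = 0 \<or> (\<exists>t. lead r t \<and> (\<forall>i<m. \<not> pp_dvd (l i) t))"
proof -
  let ?red = "\<lambda>h. \<exists>q r. h = q + r \<and> q \<in> combinations g m \<and>
    (r = 0 \<or> (\<exists>t. lead r t \<and> (\<forall>i<m. \<not> pp_dvd (l i) t)))"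
  have "?red h" if "lead h t" for h t
    using that
  proof (induction t arbitrary: h rule: wfp_induct_rule[OF wf_prec])
    case (1 t)
    show ?case
    proof (cases "\<forall>i<m. \<not> pp_dvd (l i) t")
      case True
      then show ?thesis
        using 1(2) combinations_zero by (intro exI[of _ 0] exI[of _ h]) auto
    next
      case False
      then obtain i where i: "i < m" "pp_dvd (l i) t"
        by blast
      obtain c where c: "below (h - Poly_Mapping.single (t - l i) c * g i) 0 t"
        using cancel_lead[OF 1(2) g[OF i(1)] i(2)] by blast
      let ?q = "Poly_Mapping.single (t - l i) c * g i"
      have q: "?q \<in> combinations g m"
        using i(1) by (intro combinations_mult combinations_generator)
      have "?red (h - ?q)"
      proof (cases "h - ?q = 0")
        case True
        then show ?thesis
          using combinations_zero by (intro exI[of _ 0] exI[of _ 0]) simp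
      next
        case False
        then show ?thesis
          using 1(1) below_lead[OF c] lead_lead_term by blast
      qed
      then obtain q' r where r: "h - ?q = q' + r" "q' \<in> combinations g m"
        "r = 0 \<or> (\<exists>t. lead r t \<and> (\<forall>i<m. \<not> pp_dvd (l i) t))"
        by blast
      then have "h = (q' + ?q) + r"
        by (simp add: algebra_simps)
      then show ?thesis
        using r combinations_add[OF r(2) q] by blast
    qed
  qed
  moreover have "?red 0"
    using combinations_zero by (intro exI[of _ 0]) simp
  ultimately have "?red h"
    using lead_lead_term[of h] by (cases "h = 0") blast+
  then show ?thesis
    using that by blast
qed

text \<open>
  Buchberger's product criterion for a whole system, without S-polynomials. The coefficient of the last
  polynomial can be reduced modulo the other ones, which moves the rest into their combination \<open>q\<close>.
  Then the leading terms of \<open>q\<close> and of the last summand \<open>r * g m\<close> differ, as the former is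
  divisible by some \<open>l i\<close> with \<open>i < m\<close> and, by coprimality, the latter is not. So one
  of them survives as the leading term of the sum.
\<close>

lemma combination_lead_dvd_of_coprime:
  fixes g :: "nat \<Rightarrow> ('x, 'a::field) mpol"
  assumes g: "\<And>i. i < m \<Longrightarrow> lead (g i) (l i)"
    and coprime: "\<And>i j. i < j \<Longrightarrow> j < m \<Longrightarrow> pp_coprime (l i) (l j)"
    and p: "p \<in> combinations g m" "lead p t"
  shows "\<exists>i<m. pp_dvd (l i) t"
  using assms
proof (induction m arbitrary: p t)
  case 0
  then show ?case
    by (auto simp: combinations_def lead_def)
next
  case (Suc m)
  obtain k where "p = (\<Sum>i<Suc m. k i * g i)"
    using Suc.prems(3) by (auto simp: combinations_def)
  then have pk: "p = (\<Sum>i<m. k i * g i) + k m * g m" "(\<Sum>i<m. k i * g i) \<in> combinations g m"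
    by (auto simp: combinations_def)
  obtain a r where r: "k m = a + r" "a \<in> combinations g m"
    "r = 0 \<or> (\<exists>t. lead r t \<and> (\<forall>i<m. \<not> pp_dvd (l i) t))"
    using head_reduction[of m g l "k m"] Suc.prems(1) by auto
  define q where "q = (\<Sum>i<m. k i * g i) + g m * a"
  have q: "q \<in> combinations g m"
    unfolding q_def by (intro combinations_add combinations_mult pk r)
  have p: "p = q + r * g m"
    by (simp add: pk(1) q_def r(1) algebra_simps)
  have IH: "\<exists>i<m. pp_dvd (l i) s" if "lead q s" for s
    using Suc.IH[OF _ _ q that] Suc.prems by simp
  show ?case
  proof (cases "r = 0")
    case True
    then show ?thesis
      using IH p Suc.prems(4) less_SucI by fastforce
  next
    case False
    then obtain u where u: "lead r u" "\<And>i. i < m \<Longrightarrow> \<not> pp_dvd (l i) u"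
      using r(3) by blast
    have rg: "lead (r * g m) (u + l m)"
      using u(1) Suc.prems(1) by (intro lead_mult) simp_all
    have m: "pp_dvd (l m) (u + l m)"
      by (auto simp: pp_dvd_def add.commute)
    show ?thesis
    proof (cases "q = 0")
      case True
      then have "t = u + l m"
        using rg p Suc.prems(4) lead_unique by fastforce
      then show ?thesis
        using m by blast
    next
      case False
      then obtain s where s: "lead q s"
        using lead_lead_term by blast
      then obtain i where i: "i < m" "pp_dvd (l i) s"
        using IH by blast
      then have "s \<noteq> u + l m"
        using u(2)[OF i(1)] pp_coprime_dvd_add[of "l i" "l m" u] Suc.prems(2)[OF i(1)] by auto
      then have "lead p s \<or> lead p (u + l m)"
        unfolding p by (intro lead_add_distinct s rg)
      then have "t = s \<or> t = u + l m"
        using Suc.prems(4) lead_unique by blast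
      then show ?thesis
        using i m less_SucI by blast
    qed
  qed
qed

section \<open>Reduction to zero\<close>

text \<open>
  The witnesses of a reduction. The empty sequence of steps reduces \<open>0\<close>, so that \<open>0\<close> is not a case
  of its own.
\<close>

definition reduction_steps ::
  "('x, 'a::field) mpol list \<Rightarrow> ('x, 'a) mpol \<Rightarrow> nat \<Rightarrow> (nat \<Rightarrow> ('x, 'a) mpol) \<Rightarrow> (nat \<Rightarrow> nat) \<Rightarrow> bool"
  where "reduction_steps G p s q \<nu> \<longleftrightarrow>
    (\<forall>i<s. is_monomial (q i) \<and> \<nu> i < length G) \<and>
    p = (\<Sum>i<s. q i * G ! \<nu> i) \<and>
    (\<forall>i<s. lead_term (\<prec>) (q i) + lead_term (\<prec>) (G ! \<nu> i)
             \<in> Poly_Mapping.keys (p - (\<Sum>j<i. q j * G ! \<nu> j)))"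

lemma reduces_to_zero_iff: "reduces_to_zero (\<prec>) G p \<longleftrightarrow> (\<exists>s q \<nu>. reduction_steps G p s q \<nu>)"
proof -
  have "reduction_steps G 0 0 q \<nu>" for q \<nu>
    by (simp add: reduction_steps_def)
  then show ?thesis
    unfolding reduces_to_zero_def reduction_steps_def by blast
qed

text \<open>
  Each step cancels the leading term, so the remainder stays in the ideal and its leading term
  decreases.
\<close>

lemma groebner_imp_reduces_to_zero:
  fixes G :: "('x, 'a::field) mpol list"
  assumes nz: "\<forall>g\<in>set G. g \<noteq> 0" and gb: "groebner_basis (\<prec>) G" and p: "p \<in> ideal_of (set G)"
  shows "reduces_to_zero (\<prec>) G p"
proof -
  have "reduces_to_zero (\<prec>) G p" if "lead p t" "p \<in> ideal_of (set G)" for p t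
    using that
  proof (induction t arbitrary: p rule: wfp_induct_rule[OF wf_prec])
    case (1 t)
    have "p \<noteq> 0" "lead_term (\<prec>) p = t"
      using 1(2) lead_nonzero lead_term_eq by auto
    then obtain g where g: "g \<in> set G" "pp_dvd (lead_term (\<prec>) g) t"
      using gb 1(3) unfolding groebner_basis_def by blast
    then obtain k where k: "k < length G" "g = G ! k"
      by (auto simp: in_set_conv_nth)
    obtain c where c: "c \<noteq> 0" "below (p - Poly_Mapping.single (t - lead_term (\<prec>) g) c * g) 0 t"
      using cancel_lead[OF 1(2) lead_lead_term g(2)] nz g(1) by blast
    define q0 where "q0 = Poly_Mapping.single (t - lead_term (\<prec>) g) c"
    have mon: "is_monomial q0"
      using c(1) by (auto simp: is_monomial_def q0_def)
    have lt: "lead_term (\<prec>) q0 + lead_term (\<prec>) g = t"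
      using lead_term_eq[OF lead_single[OF c(1)]] pp_dvd_add_minus[OF g(2)] by (simp add: q0_def)
    have "p - q0 * g \<in> ideal_of (set G)"
      using 1(3) g(1) by (intro ideal_of_diff ideal_of_mult)
    then have "reduces_to_zero (\<prec>) G (p - q0 * g)" if "p - q0 * g \<noteq> 0"
      using 1(1) below_lead[OF c(2)] lead_lead_term[OF that] unfolding q0_def by blast
    then have "reduces_to_zero (\<prec>) G (p - q0 * g)"
      unfolding reduces_to_zero_def by blast
    then obtain s q \<nu> where "reduction_steps G (p - q0 * g) s q \<nu>"
      by (auto simp: reduces_to_zero_iff)
    note s = this[unfolded reduction_steps_def, THEN conjunct1]
      this[unfolded reduction_steps_def, THEN conjunct2, THEN conjunct1]
      this[unfolded reduction_steps_def, THEN conjunct2, THEN conjunct2]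
    \<comment> \<open>The new step comes before those of the remainder, shifted by one position.\<close>
    let ?q = "case_nat q0 q" and ?\<nu> = "case_nat k \<nu>"
    have sum: "(\<Sum>j<Suc i. ?q j * G ! ?\<nu> j) = q0 * g + (\<Sum>j<i. q j * G ! \<nu> j)" for i
      by (simp add: sum.lessThan_Suc_shift k(2) del: sum.lessThan_Suc)
    have t_key: "t \<in> Poly_Mapping.keys p"
      using 1(2) by (simp add: lead_def)
    show ?case
      unfolding reduces_to_zero_iff reduction_steps_def
    proof (intro exI conjI)
      show "\<forall>i<Suc s. is_monomial (?q i) \<and> ?\<nu> i < length G"
        using s(1) mon k by (auto split: nat.split)
      show "p = (\<Sum>i<Suc s. ?q i * G ! ?\<nu> i)"
        unfolding sum using s(2) by (simp add: algebra_simps)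
      show "\<forall>i<Suc s. lead_term (\<prec>) (?q i) + lead_term (\<prec>) (G ! ?\<nu> i)
                 \<in> Poly_Mapping.keys (p - (\<Sum>j<i. ?q j * G ! ?\<nu> j))"
      proof (intro allI impI)
        fix i assume "i < Suc s"
        then show "lead_term (\<prec>) (?q i) + lead_term (\<prec>) (G ! ?\<nu> i)
                 \<in> Poly_Mapping.keys (p - (\<Sum>j<i. ?q j * G ! ?\<nu> j))"
          using s(3) lt k(2) t_key
          by (cases i) (simp_all add: sum diff_diff_eq del: sum.lessThan_Suc)
      qed
    qed
  qed
  then show ?thesis
    using lead_lead_term[of p] p unfolding reduces_to_zero_def by blast
qed

lemma below_mult_of_leads:
  assumes "lead p s" "lead q t" "s + t \<prec> u"
  shows "below (p * q) 0 u"
  unfolding below_def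
proof
  fix v
  assume "v \<in> Poly_Mapping.keys (p * q)"
  then obtain a b where ab: "v = a + b" "a \<in> Poly_Mapping.keys p" "b \<in> Poly_Mapping.keys q"
    by (rule in_keys_multE)
  then have "a \<preceq> s" "b \<preceq> t"
    using assms by (auto simp: lead_def)
  then have "v \<preceq> s + t"
    using ab(1) add_prec_preceq[of a s b t] add_left_mono[of b t a] by blast
  then show "v + 0 \<prec> u"
    using assms(3) prec_trans by auto
qed

text \<open>
  The leading term of each product that is subtracted is a term of the current remainder. So it is
  below \<open>u\<close> if that remainder is, and then so is the next remainder. The coefficients \<open>h j\<close>
  collect the monomials that belong to the same member of \<open>G\<close>.
\<close>

lemma reduces_to_zero_imp_combination:
  fixes G :: "('x, 'a::field) mpol list"
  assumes nz: "\<forall>g\<in>set G. g \<noteq> 0" and red: "reduces_to_zero (\<prec>) G p" and p: "below p 0 u"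
  obtains h where "p = (\<Sum>j<length G. h j * G ! j)"
    "\<And>j. j < length G \<Longrightarrow> below (h j) (lead_term (\<prec>) (G ! j)) u"
proof -
  obtain s q \<nu> where steps: "reduction_steps G p s q \<nu>"
    using red by (auto simp: reduces_to_zero_iff)
  have s: "\<And>i. i < s \<Longrightarrow> is_monomial (q i)" "\<And>i. i < s \<Longrightarrow> \<nu> i < length G"
    "p = (\<Sum>i<s. q i * G ! \<nu> i)"
    "\<And>i. i < s \<Longrightarrow> lead_term (\<prec>) (q i) + lead_term (\<prec>) (G ! \<nu> i)
               \<in> Poly_Mapping.keys (p - (\<Sum>j<i. q j * G ! \<nu> j))"
    using steps unfolding reduction_steps_def by blast+
  have lead_q: "\<exists>c. c \<noteq> 0 \<and> q i = Poly_Mapping.single (lead_term (\<prec>) (q i)) c" if "i < s" for i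
    using s(1)[OF that] lead_term_eq[OF lead_single] unfolding is_monomial_def by metis
  have step: "lead_term (\<prec>) (q i) + lead_term (\<prec>) (G ! \<nu> i) \<prec> u"
    if "i < s" "below (p - (\<Sum>j<i. q j * G ! \<nu> j)) 0 u" for i
    using s(4)[OF that(1)] that(2) by (auto simp: below_def)
  have partial: "below (p - (\<Sum>j<i. q j * G ! \<nu> j)) 0 u" if "i \<le> s" for i
    using that
  proof (induction i)
    case 0
    then show ?case
      using p by simp
  next
    case (Suc i)
    then have i: "i < s" and IH: "below (p - (\<Sum>j<i. q j * G ! \<nu> j)) 0 u"
      by simp_all
    have "G ! \<nu> i \<noteq> 0"
      using nz s(2)[OF i] by simp
    moreover have "q i \<noteq> 0"
      using lead_q[OF i] by (metis lead_single lead_nonzero)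
    ultimately have "below (q i * G ! \<nu> i) 0 u"
      using step[OF i IH] by (intro below_mult_of_leads[OF lead_lead_term lead_lead_term])
    then show ?case
      using below_diff[OF IH] by (simp add: diff_diff_eq)
  qed
  let ?h = "\<lambda>j. \<Sum>i\<in>{i \<in> {..<s}. \<nu> i = j}. q i"
  show ?thesis
  proof (rule that[of ?h])
    have "p = (\<Sum>j<length G. \<Sum>i\<in>{i \<in> {..<s}. \<nu> i = j}. q i * G ! \<nu> i)"
      unfolding s(3) using s(2) by (intro sum.group[symmetric]) auto
    then show "p = (\<Sum>j<length G. ?h j * G ! j)"
      by (simp add: sum_distrib_right)
    show "below (?h j) (lead_term (\<prec>) (G ! j)) u" if "j < length G" for j
    proof (rule below_sum)
      fix i assume i: "i \<in> {i \<in> {..<s}. \<nu> i = j}"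
      then obtain c where "q i = Poly_Mapping.single (lead_term (\<prec>) (q i)) c"
        using lead_q by blast
      then have "Poly_Mapping.keys (q i) \<subseteq> {lead_term (\<prec>) (q i)}"
        by (metis keys_single empty_subsetI order_refl)
      moreover have "lead_term (\<prec>) (q i) + lead_term (\<prec>) (G ! j) \<prec> u"
        using step[of i] partial[of i] i by auto
      ultimately show "below (q i) (lead_term (\<prec>) (G ! j)) u"
        unfolding below_def by auto
    qed
  qed
qed

text \<open>
  The two products in the S-polynomial have the same leading term, the least common multiple, with the
  same coefficient.
\<close>

lemma S_poly_below:
  fixes f g :: "('x, 'a::field) mpol"
  assumes "lead f s" "lead g t"
  shows "below (S_poly (\<prec>) f g) 0 (pp_lcm s t)"
proof -
  let ?L = "pp_lcm s t"
  have tail: "below (Poly_Mapping.single (?L - u) c * p - Poly_Mapping.single ?L (c * Poly_Mapping.lookup p u)) 0 ?L"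
    if "lead p u" "pp_dvd u ?L" "c \<noteq> 0" for p :: "('x, 'a) mpol" and u c
  proof -
    obtain q where q: "p = Poly_Mapping.single u (Poly_Mapping.lookup p u) + q" "below q 0 u"
      using lead_decompose[OF \<open>lead p u\<close>] by blast
    have L: "?L - u + u = ?L"
      using that(2) by (rule pp_dvd_add_minus)
    have "Poly_Mapping.single (?L - u) c * p = Poly_Mapping.single ?L (c * Poly_Mapping.lookup p u)
        + Poly_Mapping.single (?L - u) c * q"
      by (subst q(1)) (simp add: distrib_left mult_single L)
    moreover have "below (Poly_Mapping.single (?L - u) c * q) 0 ?L"
      using below_mult_left[OF lead_single[OF that(3)] q(2), of "?L - u"] L by simp
    ultimately show ?thesis
      by simp
  qed
  have dvd: "pp_dvd s ?L" "pp_dvd t ?L"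
    by (auto simp: pp_dvd_iff pp_lcm.rep_eq)
  have comm: "pp_lcm t s = ?L"
    by (intro poly_mapping_eqI) (simp add: pp_lcm.rep_eq max.commute)
  have lc: "Poly_Mapping.lookup f s \<noteq> 0" "Poly_Mapping.lookup g t \<noteq> 0"
    using assms by (simp_all add: lead_def in_keys_iff)
  have S: "S_poly (\<prec>) f g =
      (Poly_Mapping.single (?L - s) (Poly_Mapping.lookup g t) * f
        - Poly_Mapping.single ?L (Poly_Mapping.lookup g t * Poly_Mapping.lookup f s))
    - (Poly_Mapping.single (?L - t) (Poly_Mapping.lookup f s) * g
        - Poly_Mapping.single ?L (Poly_Mapping.lookup f s * Poly_Mapping.lookup g t))"
    using assms[THEN lead_term_eq] comm
    by (simp add: S_poly_def cofactor_def leading_coeff_def mult.commute[of "Poly_Mapping.lookup g t"])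
  show ?thesis
    unfolding S using assms dvd lc by (intro below_diff tail)
qed

section \<open>Eliminating along a chain of syzygies\<close>

lemma below_cancel_right: "below p (c + e) (u + e) \<Longrightarrow> below p c u"
  unfolding below_def using add_right_cancel_prec by (metis add.assoc)

text \<open>
  The matrix \<open>a\<close> is graded: an entry in row \<open>i\<close> and column \<open>j\<close> has weight \<open>u i\<close> if its leading
  term times \<open>c j\<close> is \<open>u i\<close>. Only the entries on the diagonal and next to it attain the weight of their row.
  Subtracting multiples of the first row clears the first column below the diagonal and preserves this
  shape, since the entries to be cleared are of lower weight. A solution \<open>P\<close> for the remaining columns
  extends to the first one by the first syzygy: its first two summands have to
  balance, and this determines the leading term of the new component. All rows are multiplied
  instead of divided, so that the solution acquires a common factor \<open>e\<close> of the leading terms; it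
  is a product of divisors of the \<open>u i\<close> and is thus coprime to \<open>d\<close>.
\<close>

lemma chain_elimination:
  fixes a :: "nat \<Rightarrow> nat \<Rightarrow> ('x, 'a::field) mpol" and g :: "nat \<Rightarrow> ('x, 'a) mpol"
  assumes syz: "\<And>i. i < n \<Longrightarrow> (\<Sum>j\<le>n. a i j * g j) = 0"
    and diag: "\<And>i. i < n \<Longrightarrow> lead (a i i) (v i) \<and> v i + c i = u i"
    and next_diag: "\<And>i. i < n \<Longrightarrow> lead (a i (Suc i)) (w i) \<and> w i + c (Suc i) = u i"
    and rest: "\<And>i j. i < n \<Longrightarrow> j \<le> n \<Longrightarrow> j \<noteq> i \<Longrightarrow> j \<noteq> Suc i \<Longrightarrow> below (a i j) (c j) (u i)"
    and coprime: "\<And>i. i < n \<Longrightarrow> pp_coprime (u i) d"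
  shows "\<exists>P e. pp_coprime e d \<and> (\<forall>j\<le>n. lead (P j) (c j + e)) \<and>
    (\<forall>j\<le>n. \<forall>k\<le>n. P j * g k = P k * g j)"
  using assms
proof (induction n arbitrary: a g v w c u)
  case 0
  show ?case
    using lead_single[of "1::'a" "c 0"]
    by (intro exI[of _ "\<lambda>_. Poly_Mapping.single (c 0) 1"] exI[of _ 0]) (simp add: pp_coprime_iff)
next
  case (Suc n)
  note syz = Suc.prems(1) and diag = Suc.prems(2) and next_diag = Suc.prems(3)
    and rest = Suc.prems(4) and coprime = Suc.prems(5)
  have split: "(\<Sum>j\<le>n. a k (Suc j) * g (Suc j)) = - (a k 0 * g 0)" if "k \<le> n" for k
  proof -
    have "a k 0 * g 0 + (\<Sum>j\<le>n. a k (Suc j) * g (Suc j)) = 0"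
      using syz[of k] that by (simp add: sum.atMost_Suc_shift del: sum.atMost_Suc)
    then show ?thesis
      by (simp add: add_eq_0_iff)
  qed
  define a' where "a' i j = a 0 0 * a (Suc i) (Suc j) - a (Suc i) 0 * a 0 (Suc j)" for i j
  have a00: "lead (a 0 0) (v 0)" "v 0 + c 0 = u 0"
    using diag[of 0] by auto
  have "pp_dvd (v 0) (u 0)"
    unfolding pp_dvd_def using a00(2) by metis
  then have coprime_v0: "pp_coprime (v 0) d"
    using coprime[of 0] pp_coprime_dvd by blast
  have low: "below (a (Suc i) 0 * a 0 (Suc j)) (c (Suc j)) (v 0 + u (Suc i))" if "i < n" "j \<le> n" for i j
  proof -
    have 1: "below (a (Suc i) 0) (c 0) (u (Suc i))"
      using rest[of "Suc i" 0] that by simp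
    have "t + c (Suc j) \<preceq> u 0" if "t \<in> Poly_Mapping.keys (a 0 (Suc j))" for t
    proof (cases "j = 0")
      case True
      then have "t \<preceq> w 0"
        using next_diag[of 0] that by (auto simp: lead_def)
      then show ?thesis
        using next_diag[of 0] add_right_mono[of t "w 0" "c (Suc 0)"] True by auto
    next
      case False
      then show ?thesis
        using rest[of 0 "Suc j"] \<open>j \<le> n\<close> that by (auto simp: below_def)
    qed
    note 2 = this
    have "t + c (Suc j) \<prec> v 0 + u (Suc i)" if t: "t \<in> Poly_Mapping.keys (a (Suc i) 0 * a 0 (Suc j))" for t
    proof -
      obtain x y where xy: "t = x + y" "x \<in> Poly_Mapping.keys (a (Suc i) 0)" "y \<in> Poly_Mapping.keys (a 0 (Suc j))"
        using t by (rule in_keys_multE)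
      have "(x + c 0) + (y + c (Suc j)) \<prec> u (Suc i) + (v 0 + c 0)"
        using add_prec_preceq[OF _ 2[OF xy(3)]] 1 xy(2) a00(2) by (simp add: below_def)
      then have "(t + c (Suc j)) + c 0 \<prec> (v 0 + u (Suc i)) + c 0"
        by (simp add: xy(1) ac_simps)
      then show ?thesis
        by (rule add_right_cancel_prec)
    qed
    then show ?thesis
      by (simp add: below_def)
  qed
  have lead': "lead (a' i j) (v 0 + s)"
    if "i < n" "j \<le> n" "lead (a (Suc i) (Suc j)) s" "s + c (Suc j) = u (Suc i)" for i j s
  proof -
    have "below (a (Suc i) 0 * a 0 (Suc j)) (0 + c (Suc j)) ((v 0 + s) + c (Suc j))"
      using low[OF that(1,2)] that(4) by (simp add: add.assoc)
    then show ?thesis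
      unfolding a'_def by (intro lead_diff_below[OF lead_mult[OF a00(1) that(3)]] below_cancel_right[of _ 0])
  qed
  have "\<exists>P e. pp_coprime e d \<and> (\<forall>j\<le>n. lead (P j) (c (Suc j) + e)) \<and>
    (\<forall>j\<le>n. \<forall>k\<le>n. P j * g (Suc k) = P k * g (Suc j))"
  proof (rule Suc.IH[of a' "\<lambda>j. g (Suc j)" "\<lambda>i. v 0 + v (Suc i)" "\<lambda>j. c (Suc j)"
        "\<lambda>i. v 0 + u (Suc i)" "\<lambda>i. v 0 + w (Suc i)"])
    fix i assume i: "i < n"
    have "(\<Sum>j\<le>n. a' i j * g (Suc j)) =
      a 0 0 * (\<Sum>j\<le>n. a (Suc i) (Suc j) * g (Suc j)) - a (Suc i) 0 * (\<Sum>j\<le>n. a 0 (Suc j) * g (Suc j))"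
      by (simp add: a'_def algebra_simps sum_subtractf sum_distrib_left)
    also have "\<dots> = a 0 0 * - (a (Suc i) 0 * g 0) - a (Suc i) 0 * - (a 0 0 * g 0)"
      using split[of "Suc i"] split[of 0] i by simp
    also have "\<dots> = 0"
      by (simp add: ac_simps)
    finally show "(\<Sum>j\<le>n. a' i j * g (Suc j)) = 0" .
    show "lead (a' i i) (v 0 + v (Suc i)) \<and> v 0 + v (Suc i) + c (Suc i) = v 0 + u (Suc i)"
      using lead'[of i i] diag[of "Suc i"] i by (auto simp: add.assoc)
    show "lead (a' i (Suc i)) (v 0 + w (Suc i)) \<and> v 0 + w (Suc i) + c (Suc (Suc i)) = v 0 + u (Suc i)"
      using lead'[of i "Suc i"] next_diag[of "Suc i"] i by (auto simp: add.assoc)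
    show "pp_coprime (v 0 + u (Suc i)) d"
      using coprime_v0 coprime[of "Suc i"] i by (intro pp_coprime_add) auto
    fix j assume j: "j \<le> n" "j \<noteq> i" "j \<noteq> Suc i"
    show "below (a' i j) (c (Suc j)) (v 0 + u (Suc i))"
      unfolding a'_def using i j rest[of "Suc i" "Suc j"]
      by (intro below_diff low below_mult_left a00) auto
  qed
  then obtain P e where P: "pp_coprime e d" "\<And>j. j \<le> n \<Longrightarrow> lead (P j) (c (Suc j) + e)"
    "\<And>j k. j \<le> n \<Longrightarrow> k \<le> n \<Longrightarrow> P j * g (Suc k) = P k * g (Suc j)"
    by blast
  define Q where "Q = case_nat (- (\<Sum>j\<le>n. a 0 (Suc j) * P j)) (\<lambda>j. a 0 0 * P j)"
  have Q0: "lead (Q 0) (c 0 + (v 0 + e))"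
  proof -
    have term0: "lead (a 0 (Suc 0) * P 0) (u 0 + e)"
      using lead_mult[OF _ P(2)[of 0], of "a 0 (Suc 0)" "w 0"] next_diag[of 0] by (simp flip: add.assoc)
    have "below (a 0 (Suc (Suc j)) * P (Suc j)) 0 (u 0 + e)" if "j < n" for j
    proof -
      have "below (a 0 (Suc (Suc j))) (c (Suc (Suc j))) (u 0)"
        using rest[of 0 "Suc (Suc j)"] that by simp
      then have "below (P (Suc j) * a 0 (Suc (Suc j))) (c (Suc (Suc j))) (c (Suc (Suc j)) + e + u 0)"
        using P(2)[of "Suc j"] that by (intro below_mult_left) auto
      then have "below (P (Suc j) * a 0 (Suc (Suc j))) (0 + c (Suc (Suc j))) ((u 0 + e) + c (Suc (Suc j)))"
        by (simp add: ac_simps)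
      then show ?thesis
        by (subst mult.commute) (rule below_cancel_right)
    qed
    then have "below (\<Sum>j<n. a 0 (Suc (Suc j)) * P (Suc j)) 0 (u 0 + e)"
      by (intro below_sum) auto
    then have "lead (\<Sum>j\<le>n. a 0 (Suc j) * P j) (u 0 + e)"
      using lead_add_below[OF term0] by (simp add: sum.atMost_shift)
    moreover have "u 0 + e = c 0 + (v 0 + e)"
      using a00(2) by (simp add: ac_simps flip: a00(2))
    ultimately show ?thesis
      by (simp add: Q_def lead_uminus)
  qed
  have Qg: "Q 0 * g (Suc k) = Q (Suc k) * g 0" if k: "k \<le> n" for k
  proof -
    have "Q 0 * g (Suc k) = - (\<Sum>j\<le>n. a 0 (Suc j) * (P j * g (Suc k)))"
      by (simp add: Q_def sum_distrib_right mult.assoc)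
    also have "\<dots> = - (\<Sum>j\<le>n. P k * (a 0 (Suc j) * g (Suc j)))"
      using P(3)[OF _ k] by (simp add: mult.left_commute)
    also have "\<dots> = P k * - (\<Sum>j\<le>n. a 0 (Suc j) * g (Suc j))"
      by (simp add: sum_distrib_left)
    also have "- (\<Sum>j\<le>n. a 0 (Suc j) * g (Suc j)) = a 0 0 * g 0"
      by (simp add: split)
    finally show ?thesis
      by (simp add: Q_def ac_simps)
  qed
  have "lead (Q j) (c j + (v 0 + e))" if "j \<le> Suc n" for j
  proof (cases j)
    case (Suc k)
    then show ?thesis
      using lead_mult[OF a00(1) P(2)[of k]] that by (simp add: Q_def ac_simps)
  qed (use Q0 in simp)
  moreover have "Q j * g k = Q k * g j" if "j \<le> Suc n" "k \<le> Suc n" for j k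
  proof (cases j; cases k)
    fix j' k' assume jk: "j = Suc j'" "k = Suc k'"
    then have "a 0 0 * (P j' * g k) = a 0 0 * (P k' * g j)"
      using P(3)[of j' k'] that by simp
    then show ?thesis
      by (simp add: Q_def jk mult.assoc)
  qed (use Qg that in auto)
  moreover have "pp_coprime (v 0 + e) d"
    using coprime_v0 P(1) by (rule pp_coprime_add)
  ultimately show ?case
    by (intro exI[of _ Q] exI[of _ "v 0 + e"]) blast
qed

section \<open>Pham-like systems\<close>

text \<open>
  Let \<open>a / b\<close> be \<open>P 0 / g 0\<close> in lowest terms. As all fractions \<open>P j / g j\<close> are equal,
  \<open>b\<close> divides every \<open>g j\<close>. If \<open>s\<close> and \<open>t\<close> are the leading terms of \<open>a\<close> and \<open>b\<close>, then
  \<open>s + d = t + e\<close>, so \<open>d\<close> divides \<open>t\<close> by coprimality with \<open>e\<close>. What remains of \<open>t\<close>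
  after division by \<open>d\<close> divides the coprime terms \<open>c 0\<close> and \<open>c 1\<close>, so nothing remains.
\<close>

lemma common_factor_of_chain:
  fixes g P :: "nat \<Rightarrow> ('x, 'a::field) mpol"
  assumes "0 < n"
    and g: "\<And>j. j \<le> n \<Longrightarrow> lead (g j) (c j + d)"
    and P: "\<And>j. j \<le> n \<Longrightarrow> lead (P j) (c j + e)"
    and proportional: "\<And>j. j \<le> n \<Longrightarrow> P 0 * g j = P j * g 0"
    and coprime: "pp_coprime (c 0) (c 1)" "pp_coprime e d"
  obtains b f where "lead b d" "\<And>j. j \<le> n \<Longrightarrow> g j = b * f j"
proof -
  have "g 0 \<noteq> 0" "P 0 \<noteq> 0"
    using g[of 0] P[of 0] lead_nonzero by auto
  obtain m a b where ab: "P 0 = m * a" "g 0 = m * b" "\<And>h. b dvd a * h \<Longrightarrow> b dvd h"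
    using ex_coprime_quotients[OF \<open>g 0 \<noteq> 0\<close>, of "P 0"] by blast
  have nz: "m \<noteq> 0" "a \<noteq> 0" "b \<noteq> 0"
    using ab \<open>g 0 \<noteq> 0\<close> \<open>P 0 \<noteq> 0\<close> by auto
  have b_dvd: "b dvd g j" if "j \<le> n" for j
  proof -
    have "m * (a * g j) = m * (b * P j)"
      using proportional[OF that] by (simp add: ab ac_simps)
    then have "a * g j = b * P j"
      by (rule mpol_mult_left_cancel[OF nz(1)])
    then show ?thesis
      using ab(3)[of "g j"] by simp
  qed
  obtain s t r where lead: "lead a s" "lead b t" "lead m r"
    using lead_lead_term nz by blast
  have "r + s = c 0 + e" "r + t = c 0 + d"
    using lead_mult[OF lead(3,1)] lead_mult[OF lead(3,2)] P[of 0] g[of 0] ab lead_unique by auto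
  then have "(r + s) + (c 0 + d) = (c 0 + e) + (r + t)"
    by simp
  then have "(r + c 0) + (s + d) = (r + c 0) + (t + e)"
    by (simp only: ac_simps)
  then have "s + d = t + e"
    by simp
  then have "pp_dvd d (t + e)"
    unfolding pp_dvd_def by (metis add.commute)
  then have "pp_dvd d t"
    using pp_coprime_dvd_add pp_coprime_sym coprime(2) by blast
  then obtain u where u: "t = d + u"
    by (auto simp: pp_dvd_def)
  have "pp_dvd u (c j)" if "j \<le> n" for j
  proof -
    have "pp_dvd (d + u) (c j + d)"
      using lead_dvd[OF b_dvd[OF that] lead(2) g[OF that]] u by simp
    then show ?thesis
      by (simp add: pp_dvd_iff lookup_add)
  qed
  from this[of 0] this[of 1] have "u = 0"
    using coprime(1) \<open>0 < n\<close> by (simp add: pp_coprime_def)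
  then have "lead b d"
    using lead(2) u by simp
  moreover have "\<forall>j. \<exists>k. j \<le> n \<longrightarrow> g j = b * k"
    using b_dvd by (auto simp: dvd_def)
  then have "\<exists>f. \<forall>j. j \<le> n \<longrightarrow> g j = b * f j"
    by (rule choice)
  ultimately show ?thesis
    using that by blast
qed

lemma groebner_of_common_factor:
  fixes G :: "('x, 'a::field) mpol list"
  assumes b: "lead b d" and f: "\<And>j. j < length G \<Longrightarrow> G ! j = b * f j"
    and G: "\<And>j. j < length G \<Longrightarrow> lead (G ! j) (c j + d)"
    and coprime: "\<And>i j. i < j \<Longrightarrow> j < length G \<Longrightarrow> pp_coprime (c i) (c j)"
  shows "groebner_basis (\<prec>) G"
  unfolding groebner_basis_def
proof (intro ballI impI)
  fix p
  assume p: "p \<in> ideal_of (set G)" "p \<noteq> 0"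
  then obtain h where h: "p = (\<Sum>j<length G. h j * G ! j)"
    using ideal_of_subset_combinations[of G] by (auto simp: combinations_def)
  let ?q = "\<Sum>j<length G. h j * f j"
  have pq: "p = b * ?q"
    unfolding h sum_distrib_left using f by (intro sum.cong) (simp_all add: mult.left_commute)
  then have "?q \<noteq> 0"
    using p(2) by auto
  then obtain t where t: "lead ?q t"
    using lead_lead_term by blast
  have "lead (f j) (c j)" if "j < length G" for j
  proof -
    have "f j \<noteq> 0"
      using f[OF that] G[OF that] lead_nonzero by fastforce
    then obtain s where s: "lead (f j) s"
      using lead_lead_term by blast
    then have "d + s = c j + d"
      using lead_mult[OF b s] f[OF that] G[OF that] lead_unique by simp
    with s show ?thesis
      by (simp add: add.commute)
  qed
  moreover have "?q \<in> combinations f (length G)"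
    by (auto simp: combinations_def)
  ultimately obtain i where i: "i < length G" "pp_dvd (c i) t"
    using combination_lead_dvd_of_coprime[of "length G" f c ?q t] coprime t by blast
  have "lead_term (\<prec>) p = d + t" "lead_term (\<prec>) (G ! i) = c i + d"
    using lead_mult[OF b t] pq G[OF i(1)] by (auto intro: lead_term_eq)
  moreover have "pp_dvd (c i + d) (d + t)"
    using i(2) by (simp add: pp_dvd_iff lookup_add)
  ultimately show "\<exists>g\<in>set G. pp_dvd (lead_term (\<prec>) g) (lead_term (\<prec>) p)"
    using i(1) by (metis nth_mem)
qed

text \<open>
  Subtract from the definition of the S-polynomial its representation obtained by the reduction. The latter
  lies below the least common multiple \<open>c i + c (Suc i) + d\<close> and does not affect the two leading
  terms; the common summand \<open>d\<close> cancels from all bounds.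
\<close>

lemma S_poly_syzygy:
  fixes G :: "('x, 'a::field) mpol list"
  assumes G: "\<And>j. j < length G \<Longrightarrow> lead (G ! j) (c j + d)"
    and i: "Suc i < length G" and coprime: "pp_coprime (c i) (c (Suc i))"
    and red: "reduces_to_zero (\<prec>) G (S_poly (\<prec>) (G ! i) (G ! Suc i))"
  shows "\<exists>a. (\<Sum>j<length G. a j * G ! j) = 0 \<and>
    lead (a i) (c (Suc i)) \<and> lead (a (Suc i)) (c i) \<and>
    (\<forall>j<length G. j \<noteq> i \<longrightarrow> j \<noteq> Suc i \<longrightarrow> below (a j) (c j) (c i + c (Suc i)))"
proof -
  let ?S = "S_poly (\<prec>) (G ! i) (G ! Suc i)"
  have Gi: "lead (G ! i) (c i + d)" "lead (G ! Suc i) (c (Suc i) + d)"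
    using G[of i] G[of "Suc i"] i by auto
  note lt = Gi[THEN lead_term_eq]
  have lcm: "pp_lcm (c i + d) (c (Suc i) + d) = c i + c (Suc i) + d"
    "pp_lcm (c (Suc i) + d) (c i + d) = c i + c (Suc i) + d"
    using pp_lcm_coprime[OF coprime] pp_lcm_coprime[OF pp_coprime_sym[OF coprime]]
    by (simp_all add: add.commute)
  have nz: "\<forall>g\<in>set G. g \<noteq> 0"
    using G lead_nonzero by (metis in_set_conv_nth)
  have "below ?S 0 (c i + c (Suc i) + d)"
    using S_poly_below[OF Gi] lcm by simp
  then obtain h where h: "?S = (\<Sum>j<length G. h j * G ! j)"
    "\<And>j. j < length G \<Longrightarrow> below (h j) (lead_term (\<prec>) (G ! j)) (c i + c (Suc i) + d)"
    using reduces_to_zero_imp_combination[OF nz red] by blast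
  have low: "below (h j) (c j) (c i + c (Suc i))" if "j < length G" for j
    using h(2)[OF that] lead_term_eq[OF G[OF that]] below_cancel_right by simp
  define x where "x = leading_coeff (\<prec>) (G ! Suc i)"
  define y where "y = leading_coeff (\<prec>) (G ! i)"
  have xy: "x \<noteq> 0" "y \<noteq> 0"
    using Gi lt by (simp_all add: x_def y_def leading_coeff_def lead_def in_keys_iff)
  have "cofactor (\<prec>) (G ! i) (G ! Suc i) = c (Suc i)" "cofactor (\<prec>) (G ! Suc i) (G ! i) = c i"
    unfolding cofactor_def lt lcm by (intro poly_mapping_eqI; simp add: lookup_add lookup_minus)+
  then have S: "?S = Poly_Mapping.single (c (Suc i)) x * G ! i - Poly_Mapping.single (c i) y * G ! Suc i"
    by (simp add: S_poly_def x_def y_def)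
  define k where "k j = (if j = i then Poly_Mapping.single (c (Suc i)) x
    else if j = Suc i then - Poly_Mapping.single (c i) y else 0)" for j
  define a where "a j = k j - h j" for j
  have "(\<Sum>j<length G. k j * G ! j) = (\<Sum>j\<in>{i, Suc i}. k j * G ! j)"
    using i by (intro sum.mono_neutral_right) (auto simp: k_def)
  also have "\<dots> = ?S"
    by (simp add: k_def S)
  finally have "(\<Sum>j<length G. a j * G ! j) = 0"
    using h(1) by (simp add: a_def left_diff_distrib sum_subtractf)
  moreover have "lead (a i) (c (Suc i))"
  proof -
    have "below (h i) 0 (c (Suc i))"
      using low[of i] i by (intro below_cancel_right[of _ 0 "c i"]) (simp add: add.commute)
    then show ?thesis
      using lead_single[OF xy(1), of "c (Suc i)"] by (simp add: a_def k_def lead_diff_below)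
  qed
  moreover have "lead (a (Suc i)) (c i)"
  proof -
    have "below (h (Suc i)) 0 (c i)"
      using low[of "Suc i"] i by (intro below_cancel_right[of _ 0 "c (Suc i)"]) simp
    then show ?thesis
      using lead_uminus[OF lead_single[OF xy(2), of "c i"]] by (simp add: a_def k_def lead_diff_below)
  qed
  moreover have "below (a j) (c j) (c i + c (Suc i))" if "j < length G" "j \<noteq> i" "j \<noteq> Suc i" for j
    using that below_uminus[OF low[of j]] by (simp add: a_def k_def)
  ultimately show ?thesis
    by blast
qed

lemma groebner_of_consecutive_S_polys:
  fixes G :: "('x, 'a::field) mpol list"
  assumes len: "length G \<ge> 1" and nz: "\<forall>g\<in>set G. g \<noteq> 0" and pham: "pham_like (\<prec>) G"
    and red: "\<And>i. Suc i < length G \<Longrightarrow> reduces_to_zero (\<prec>) G (S_poly (\<prec>) (G ! i) (G ! Suc i))"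
  shows "groebner_basis (\<prec>) G"
proof -
  obtain c d where cd: "\<And>i. i < length G \<Longrightarrow> lead_term (\<prec>) (G ! i) = c i + d"
    "\<And>i. i < length G \<Longrightarrow> pp_coprime (c i) d"
    "\<And>i j. i < length G \<Longrightarrow> j < length G \<Longrightarrow> i \<noteq> j \<Longrightarrow> pp_coprime (c i) (c j)"
    using pham unfolding pham_like_def by blast
  have G: "lead (G ! i) (c i + d)" if "i < length G" for i
    using lead_lead_term[of "G ! i"] nz cd(1)[OF that] that by simp
  obtain n where n: "length G = Suc n"
    using len by (cases "length G") auto
  show ?thesis
  proof (cases "n = 0")
    case True
    \<comment> \<open>A single polynomial: its whole leading term takes the role of \<open>c\<close>, and the common factor is \<open>1\<close>.\<close>
    show ?thesis
    proof (rule groebner_of_common_factor)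
      show "lead (1 :: ('x, 'a) mpol) 0"
        using lead_single[of "1::'a" 0] by simp
      show "G ! j = 1 * G ! j" for j
        by simp
      show "lead (G ! j) ((c j + d) + 0)" if "j < length G" for j
        using G[OF that] by simp
    qed (use n True in auto)
  next
    case False
    have "\<exists>a. (\<Sum>j\<le>n. a j * G ! j) = 0 \<and>
      lead (a i) (c (Suc i)) \<and> lead (a (Suc i)) (c i) \<and>
      (\<forall>j\<le>n. j \<noteq> i \<longrightarrow> j \<noteq> Suc i \<longrightarrow> below (a j) (c j) (c i + c (Suc i)))" if "i < n" for i
      using S_poly_syzygy[OF G _ _ red, of i] cd(3)[of i "Suc i"] that
      by (simp add: n lessThan_Suc_atMost less_Suc_eq_le)
    then have "\<exists>a. \<forall>i<n. (\<Sum>j\<le>n. a i j * G ! j) = 0 \<and>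
      lead (a i i) (c (Suc i)) \<and> lead (a i (Suc i)) (c i) \<and>
      (\<forall>j\<le>n. j \<noteq> i \<longrightarrow> j \<noteq> Suc i \<longrightarrow> below (a i j) (c j) (c i + c (Suc i)))"
      by (intro choice) blast
    then obtain a where a: "\<And>i. i < n \<Longrightarrow> (\<Sum>j\<le>n. a i j * G ! j) = 0"
      "\<And>i. i < n \<Longrightarrow> lead (a i i) (c (Suc i))" "\<And>i. i < n \<Longrightarrow> lead (a i (Suc i)) (c i)"
      "\<And>i j. i < n \<Longrightarrow> j \<le> n \<Longrightarrow> j \<noteq> i \<Longrightarrow> j \<noteq> Suc i \<Longrightarrow> below (a i j) (c j) (c i + c (Suc i))"
      by blast
    have "\<exists>P e. pp_coprime e d \<and> (\<forall>j\<le>n. lead (P j) (c j + e)) \<and>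
      (\<forall>j\<le>n. \<forall>k\<le>n. P j * G ! k = P k * G ! j)"
    proof (rule chain_elimination[where v = "\<lambda>i. c (Suc i)" and w = c and u = "\<lambda>i. c i + c (Suc i)"])
      fix i assume i: "i < n"
      show "(\<Sum>j\<le>n. a i j * G ! j) = 0"
        by (rule a(1)[OF i])
      show "lead (a i i) (c (Suc i)) \<and> c (Suc i) + c i = c i + c (Suc i)"
        using a(2)[OF i] by (simp add: add.commute)
      show "lead (a i (Suc i)) (c i) \<and> c i + c (Suc i) = c i + c (Suc i)"
        using a(3)[OF i] by simp
      show "pp_coprime (c i + c (Suc i)) d"
        using cd(2)[of i] cd(2)[of "Suc i"] i n by (intro pp_coprime_add) simp_all
      show "below (a i j) (c j) (c i + c (Suc i))" if "j \<le> n" "j \<noteq> i" "j \<noteq> Suc i" for j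
        using a(4)[OF i that] .
    qed
    then obtain P e where P: "pp_coprime e d" "\<And>j. j \<le> n \<Longrightarrow> lead (P j) (c j + e)"
      "\<And>j. j \<le> n \<Longrightarrow> P 0 * G ! j = P j * G ! 0"
      by blast
    obtain b f where b: "lead b d" "\<And>j. j \<le> n \<Longrightarrow> G ! j = b * f j"
    proof (rule common_factor_of_chain)
      show "0 < n" "pp_coprime e d" "pp_coprime (c 0) (c 1)"
        using False P(1) cd(3)[of 0 1] n by auto
      show "lead (G ! j) (c j + d)" if "j \<le> n" for j
        using G that n by simp
    qed (use P in blast)+
    show ?thesis
      by (rule groebner_of_common_factor[OF b(1) _ G cd(3)]) (use b(2) n in auto)
  qed
qed

end

theorem corollary23:
  fixes prec :: "('x::finite \<Rightarrow>\<^sub>0 nat) \<Rightarrow> ('x \<Rightarrow>\<^sub>0 nat) \<Rightarrow> bool"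
    and G :: "(('x \<Rightarrow>\<^sub>0 nat) \<Rightarrow>\<^sub>0 'a::field) list"
  assumes "admissible prec"
    and "length G \<ge> 1"
    and "\<forall>g\<in>set G. g \<noteq> 0"
    and "pham_like prec G"
  shows "groebner_basis prec G \<longleftrightarrow>
    (\<forall>i. i + 1 < length G \<longrightarrow> reduces_to_zero prec G (S_poly prec (G ! i) (G ! (i + 1))))"
proof -
  interpret term_order prec
    using assms(1) by unfold_locales
  show ?thesis
  proof (intro iffI allI impI)
    fix i
    assume "groebner_basis prec G" "i + 1 < length G"
    then show "reduces_to_zero prec G (S_poly prec (G ! i) (G ! (i + 1)))"
      by (intro groebner_imp_reduces_to_zero assms(3) S_poly_in_ideal) simp_all
  next
    assume "\<forall>i. i + 1 < length G \<longrightarrow> reduces_to_zero prec G (S_poly prec (G ! i) (G ! (i + 1)))"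
    then show "groebner_basis prec G"
      using groebner_of_consecutive_S_polys[OF assms(2-4)] by simp
  qed
qed

end
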